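(* Let $i,k,\ell\in\mathbb{Z}$ with $k\ge 1$ and $0\le i\le k$, and write $N_j:=n_j+n_{j+1}+\cdots+n_k$ for $1\le j\le k$. Then $$\frac{(-q)_\infty}{(q)_\infty}\left(\sum_{n\ge|\ell|}-\sum_{n\le-|\ell|-1}\right)q^{\left(k+\frac12\right)\left(n+\frac{2i-1}{4k+2}\right)^2-\frac{\left(2k\ell+i+\ell-\frac12\right)^2}{4k+2}}\,(1+q^n)$$ $$=\sum_{n_1,n_2,\dots,n_k\ge0}\frac{q^{\frac{N_1(N_1+1)}{2}+N_2^2+N_3^2+\cdots+N_k^2+\ell N_1+(2\ell+1)(N_2+N_3+\cdots+N_k)-N_1-N_2-\cdots-N_{k-i}}\,(-q)_{N_1+\ell}}{(q)_{n_1}(q)_{n_2}\cdots(q)_{n_k}\,(q)_{n_k+2\ell}}.$$ Furthermore, the case $i=k$ simplifies as $$\frac{(-q)_\infty}{(q)_\infty}\left(\sum_{n\ge|\ell|}-\sum_{n\le-|\ell|-1}\right)q^{\left(k+\frac12\right)\left(n+\frac{2k-1}{4k+2}\right)^2-\frac{\left(2k\ell+k+\ell-\frac12\right)^2}{4k+2}}$$ $$=\sum_{n_1,n_2,\dots,n_k\ge0}\frac{q^{\frac{N_1(N_1+1)}{2}+N_2^2+N_3^2+\cdots+N_k^2+\ell N_1+(2\ell+1)(N_2+N_3+\cdots+N_k)}\,(-q)_{N_1+\ell}}{(q)_{n_1}(q)_{n_2}\cdots(q)_{n_k}\,(q)_{n_k+2\ell}}.$$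
   Context: Conventions: $q=e^{2\pi i\tau}$ with $\operatorname{Im}\tau>0$ (so $|q|<1$), and $q^r:=e^{2\pi i r\tau}$ for rational $r$ (here, in $e^{2\pi i\tau}$, $i$ is the imaginary unit; elsewhere $i$ is an integer index). The $q$-Pochhammer symbols are $(a)_n=(a;q)_n:=\prod_{j=1}^n(1-aq^{j-1})$ for $n\ge0$, $(a)_\infty:=\prod_{j\ge1}(1-aq^{j-1})$. By convention $1/(q)_m=0$ for integers $m<0$, so that summands on the right with $n_k+2\ell<0$ are zero. The expression $-N_1-N_2-\cdots-N_{k-i}$ means $-\sum_{j=1}^{k-i}N_j$, which is empty (zero) when $i=k$; likewise $N_2^2+\cdots+N_k^2$ and $N_2+\cdots+N_k$ are zero when $k=1$. The notation $\left(\sum_{n\ge|\ell|}-\sum_{n\le-|\ell|-1}\right)f(n)$ means $\sum_{n\ge|\ell|}f(n)-\sum_{n\le-|\ell|-1}f(n)$ with $n\in\mathbb{Z}$. *)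

theory Defs
  imports "HOL-Analysis.Analysis"
begin

text \<open>
  The power \<open>q\<^sup>r\<close> for \<open>q = e\<^sup>2\<^sup>\<pi>\<^sup>i\<^sup>\<tau>\<close>. It depends on \<open>\<tau>\<close> and not just on \<open>q\<close>, so it is
  not \<open>q powr r\<close>, which would use the principal branch of the logarithm.
\<close>
definition qpow :: "complex \<Rightarrow> real \<Rightarrow> complex" where
  "qpow \<tau> r = exp (2 * complex_of_real pi * \<i> * complex_of_real r * \<tau>)"

definition qpoch :: "complex \<Rightarrow> complex \<Rightarrow> nat \<Rightarrow> complex" where
  "qpoch a q n = (\<Prod>j=1..n. 1 - a * q ^ (j - 1))"

definition qpoch_inf :: "complex \<Rightarrow> complex \<Rightarrow> complex" where
  "qpoch_inf a q = (\<Prod>j. 1 - a * q ^ j)"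

text \<open>\<open>1 / (q)\<^sub>m\<close> for integer \<open>m\<close>, with the convention that it vanishes for \<open>m < 0\<close>.\<close>
definition inv_qpoch :: "complex \<Rightarrow> int \<Rightarrow> complex" where
  "inv_qpoch q m = (if m < 0 then 0 else 1 / qpoch q q (nat m))"

definition tail_sum :: "nat \<Rightarrow> (nat \<Rightarrow> nat) \<Rightarrow> nat \<Rightarrow> nat" where
  "tail_sum k n j = (\<Sum>r=j..k. n r)"

text \<open>
  The summand of the multiple series with exponent \<open>e\<close>. The truncation in
  \<open>nat (N\<^sub>1 + l)\<close> is harmless: \<open>N\<^sub>1 + l < 0\<close> forces \<open>n\<^sub>k + 2l < 0\<close>, so that the
  factor \<open>inv_qpoch\<close> is zero.
\<close>
definition multi_summand :: "complex \<Rightarrow> nat \<Rightarrow> int \<Rightarrow> real \<Rightarrow> (nat \<Rightarrow> nat) \<Rightarrow> complex" where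
  "multi_summand \<tau> k l e n =
     (let q = qpow \<tau> 1 in
      qpow \<tau> e * qpoch (- q) q (nat (int (tail_sum k n 1) + l))
        / (\<Prod>r=1..k. qpoch q q (n r)) * inv_qpoch q (int (n k) + 2 * l))"

text \<open>The summation range \<open>n\<^sub>1, \<dots>, n\<^sub>k \<ge> 0\<close>; extensionality makes each tuple occur once.\<close>
definition tuples :: "nat \<Rightarrow> (nat \<Rightarrow> nat) set" where
  "tuples k = {1..k} \<rightarrow>\<^sub>E UNIV"

end

theory Submission
  imports Defs
begin

text \<open>
  The identity is the limit \<open>L \<rightarrow> \<infinity>\<close> of a finite identity that comes from a Bailey chain with
  bilateral pairs. Substituting \<open>M\<^sub>j = N\<^sub>j + l\<close> turns the last two denominators into
  \<open>(q)\<^bsub>M\<^sub>k - l\<^esub> (q)\<^bsub>M\<^sub>k + l\<^esub>\<close> and the exponents into quadratic polynomials in the \<open>M\<^sub>j\<close> from which only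
  the same polynomials at \<open>l\<close> are subtracted. With \<open>1 / (q)\<^sub>m = 0\<close> for \<open>m < 0\<close>, no case
  distinction on the sign of \<open>l\<close> is needed. Put
    \<open>A\<^sub>r(M) = 1 / ((q)\<^bsub>M - r\<^esub> (q)\<^bsub>M + r\<^esub>)\<close> and \<open>B\<^sub>r(M) = 1 / ((q)\<^bsub>M - r\<^esub> (q)\<^bsub>M + r + 1\<^esub>)\<close>,
  the kernels of Bailey pairs relative to \<open>1\<close> and to \<open>q\<close>. They satisfy
    \<open>(1 - q\<^bsup>2r+1\<^esup>) B\<^sub>r = A\<^sub>r - q\<^bsup>2r+1\<^esup> A\<^bsub>r+1\<^esub>\<close> (lemma \<open>B_to_A\<close>),
  and telescoping gives \<open>A\<^sub>l = \<Sum>\<^bsub>r \<ge> |l|\<^esub> q\<^bsup>r\<^sup>2 - l\<^sup>2\<^esup> (1 - q\<^bsup>2r+1\<^esup>) B\<^sub>r\<close> (lemma \<open>unit_expansion\<close>).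

  Summation over one \<open>M\<^sub>j\<close> with \<open>j \<ge> 2\<close> acts diagonally on these kernels: by a case of the
  q-Chu-Vandermonde sum, \<open>\<Sum>\<^sub>M q\<^bsup>M\<^sup>2\<^esup> A\<^sub>r(M) / (q)\<^bsub>L - M\<^esub> = q\<^bsup>r\<^sup>2\<^esup> A\<^sub>r(L)\<close>, and the same with
  \<open>M\<^sup>2 + M\<close>, \<open>r\<^sup>2 + r\<close> and \<open>B\<^sub>r\<close>. For \<open>i < k\<close> the \<open>i\<close> innermost variables
  carry the exponent \<open>M\<^sup>2 + M\<close> and the other ones \<open>M\<^sup>2\<close>, and \<open>B\<^sub>r\<close> is converted into \<open>A\<^sub>r\<close> in between;
  for \<open>i = k\<close> all of them carry \<open>M\<^sup>2 + M\<close>. The outermost variable, which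
  has the additional factor \<open>(-q)\<^sub>M\<close>, is summed by the terminating q-Gauss sum (lemmas
  \<open>final_step_A\<close> and \<open>final_step_B\<close>); it produces the factor \<open>1 + q\<^sup>r\<close> when it acts on \<open>A\<^sub>r\<close>, that is
  for \<open>i < k\<close>, and no such factor when it acts on \<open>B\<^sub>r\<close>, that is for \<open>i = k\<close>. In the result, the
  two parts of each difference \<open>A\<^sub>r - q\<^bsup>2r+1\<^esup> A\<^bsub>r+1\<^esub>\<close> have as coefficients the terms of the
  theta-like series at the indices \<open>r\<close> and \<open>-1 - r\<close>: this is where the difference of the two one-sided sums comes from.

  Dominated convergence then gives the theorem for \<open>i < k\<close> and the simplified form for
  \<open>i = k\<close>. The first form for \<open>i = k\<close> differs from the second by the terms with the
  extra factor \<open>q\<^sup>n\<close>, which are invariant under \<open>n \<mapsto> -1 - n\<close> and cancel (lemma \<open>theta_pairing\<close>).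
\<close>

section \<open>Finite and infinite sums\<close>

lemma sum_PiE_insert:
  assumes "a \<notin> S"
  shows "(\<Sum>n\<in>PiE (insert a S) (\<lambda>_. X). F n) = (\<Sum>n\<in>PiE S (\<lambda>_. X). \<Sum>x\<in>X. F (n(a := x)))"
proof -
  have "(\<Sum>n\<in>PiE (insert a S) (\<lambda>_. X). F n) = (\<Sum>(x, n)\<in>X \<times> PiE S (\<lambda>_. X). F (n(a := x)))"
    unfolding PiE_insert_eq
    by (subst sum.reindex[OF inj_combinator[OF assms]]) (simp add: case_prod_unfold)
  also have "\<dots> = (\<Sum>x\<in>X. \<Sum>n\<in>PiE S (\<lambda>_. X). F (n(a := x)))"
    by (simp add: sum.cartesian_product)
  also have "\<dots> = (\<Sum>n\<in>PiE S (\<lambda>_. X). \<Sum>x\<in>X. F (n(a := x)))"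
    by (rule sum.swap)
  finally show ?thesis .
qed

lemma tail_sum_split: "a \<le> k \<Longrightarrow> tail_sum k n a = n a + tail_sum k n (Suc a)"
  by (simp add: tail_sum_def sum.atLeast_Suc_atMost)

lemma tail_sum_upd: "a < j \<Longrightarrow> tail_sum k (n(a := x)) j = tail_sum k n j"
  by (simp add: tail_sum_def)

lemma infsum_diff:
  fixes f g :: "'a \<Rightarrow> complex"
  assumes "f summable_on X" "g summable_on X"
  shows "infsum (\<lambda>x. f x - g x) X = infsum f X - infsum g X"
  using infsum_add[of f X "\<lambda>x. - g x"] assms by (simp add: summable_on_uminus infsum_uminus)

text \<open>
  Dominated convergence for sums over an arbitrary set, with weights that are uniformly bounded
  and converge pointwise to a constant.
\<close>
lemma tendsto_weighted_infsum:
  fixes f :: "'a \<Rightarrow> complex" and W :: "nat \<Rightarrow> 'a \<Rightarrow> complex"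
  assumes "(\<lambda>x. norm (f x)) summable_on X"
    and "\<And>b x. x \<in> X \<Longrightarrow> norm (W b x) \<le> K"
    and "\<And>x. x \<in> X \<Longrightarrow> (\<lambda>b. W b x) \<longlonglongrightarrow> c"
  shows "(\<lambda>b. infsum (\<lambda>x. W b x * f x) X) \<longlonglongrightarrow> c * infsum f X"
proof -
  have int: "integrable (count_space X) f"
    using assms(1) unfolding abs_summable_equivalent abs_summable_on_def .
  have bound: "norm (W b x * f x) \<le> K * norm (f x)" if "x \<in> X" for b x
    using assms(2)[OF that] by (simp add: norm_mult mult_right_mono)
  have intW: "integrable (count_space X) (\<lambda>x. W b x * f x)" for b
    by (rule Bochner_Integration.integrable_bound[OF integrable_mult_right[OF integrable_norm[OF int], of K]])
      (auto simp: AE_count_space intro!: order_trans[OF bound])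
  have "(\<lambda>b. lebesgue_integral (count_space X) (\<lambda>x. W b x * f x)) \<longlonglongrightarrow> lebesgue_integral (count_space X) (\<lambda>x. c * f x)"
  proof (rule integral_dominated_convergence)
    show "integrable (count_space X) (\<lambda>x. K * norm (f x))"
      using int by (intro integrable_mult_right integrable_norm)
    show "AE x in count_space X. (\<lambda>b. W b x * f x) \<longlonglongrightarrow> c * f x"
      by (auto simp: AE_count_space intro!: tendsto_mult assms(3))
    show "AE x in count_space X. norm (W b x * f x) \<le> K * norm (f x)" for b
      by (auto simp: AE_count_space bound)
  qed auto
  moreover have "lebesgue_integral (count_space X) (\<lambda>x. W b x * f x) = infsum (\<lambda>x. W b x * f x) X" for b
    using infsetsum_infsum[of "\<lambda>x. W b x * f x" X] intW[of b]
    unfolding infsetsum_def abs_summable_on_def by simp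
  moreover have "lebesgue_integral (count_space X) (\<lambda>x. c * f x) = c * infsum f X"
    using infsetsum_infsum[of f X] int unfolding infsetsum_def abs_summable_on_def
    by (simp only: integral_mult_right_zero)
  ultimately show ?thesis by (simp only:)
qed

text \<open>
  The reflection \<open>n \<mapsto> -1 - n\<close> exchanges the two ranges of summation, so the difference of the
  two one-sided sums is a single sum over \<open>r \<ge> |l|\<close>.
\<close>
lemma abs_summable_int_fold:
  fixes f :: "int \<Rightarrow> complex"
  assumes "(\<lambda>n. norm (f n)) summable_on UNIV"
  shows "(\<lambda>r. norm (f (int r))) summable_on {nat \<bar>l\<bar>..}"
    and "(\<lambda>r. norm (f (- 1 - int r))) summable_on {nat \<bar>l\<bar>..}"
    and "f summable_on {\<bar>l\<bar>..}" and "f summable_on {..- \<bar>l\<bar> - 1}"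
    and "infsum f {\<bar>l\<bar>..} - infsum f {..- \<bar>l\<bar> - 1} = infsum (\<lambda>r. f (int r) - f (- 1 - int r)) {nat \<bar>l\<bar>..}"
proof -
  have s: "f summable_on X" "(\<lambda>n. norm (f n)) summable_on X" for X
    using assms by (auto intro: abs_summable_summable summable_on_subset_banach)
  have i1: "{\<bar>l\<bar>..} = int ` {nat \<bar>l\<bar>..}" and i2: "{..- \<bar>l\<bar> - 1} = (\<lambda>r. - 1 - int r) ` {nat \<bar>l\<bar>..}"
  proof -
    have "x \<in> int ` {nat \<bar>l\<bar>..}" if "\<bar>l\<bar> \<le> x" for x
      using that by (intro image_eqI[of _ _ "nat x"]) auto
    then show "{\<bar>l\<bar>..} = int ` {nat \<bar>l\<bar>..}" by auto
    have "x \<in> (\<lambda>r. - 1 - int r) ` {nat \<bar>l\<bar>..}" if "x \<le> - \<bar>l\<bar> - 1" for x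
      using that by (intro image_eqI[of _ _ "nat (- 1 - x)"]) auto
    then show "{..- \<bar>l\<bar> - 1} = (\<lambda>r. - 1 - int r) ` {nat \<bar>l\<bar>..}" by auto
  qed
  have inj: "inj_on (\<lambda>r. - 1 - int r) X" for X by (auto simp: inj_on_def)
  show "f summable_on {\<bar>l\<bar>..}" "f summable_on {..- \<bar>l\<bar> - 1}" by (rule s)+
  then have "(\<lambda>r. f (int r)) summable_on {nat \<bar>l\<bar>..}" "(\<lambda>r. f (- 1 - int r)) summable_on {nat \<bar>l\<bar>..}"
    unfolding i1 i2 by (simp_all add: summable_on_reindex inj o_def)
  then show "infsum f {\<bar>l\<bar>..} - infsum f {..- \<bar>l\<bar> - 1} = infsum (\<lambda>r. f (int r) - f (- 1 - int r)) {nat \<bar>l\<bar>..}"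
    unfolding i1 i2 by (simp add: infsum_reindex inj o_def infsum_diff)
  show "(\<lambda>r. norm (f (int r))) summable_on {nat \<bar>l\<bar>..}"
    using s(2)[of "int ` {nat \<bar>l\<bar>..}"] by (simp add: summable_on_reindex o_def)
  show "(\<lambda>r. norm (f (- 1 - int r))) summable_on {nat \<bar>l\<bar>..}"
    using s(2)[of "(\<lambda>r. - 1 - int r) ` {nat \<bar>l\<bar>..}"] by (simp add: summable_on_reindex inj o_def)
qed

lemma quadratic_bound:
  fixes k s :: real and n :: int
  assumes "1 / 2 \<le> k" "\<bar>s\<bar> \<le> k"
  shows "\<bar>of_int n\<bar> - 2 * k \<le> k * of_int n ^ 2 + s * of_int n"
proof -
  \<comment> \<open>No integer lies strictly between 1 and 2.\<close>
  have "0 \<le> (\<bar>n\<bar> - 1) * (\<bar>n\<bar> - 2)"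
    by (cases "\<bar>n\<bar> \<le> 1") (auto intro: mult_nonpos_nonpos mult_nonneg_nonneg)
  then have "3 * \<bar>n\<bar> - 2 \<le> n ^ 2"
    by (simp add: algebra_simps power2_eq_square flip: abs_mult)
  then have "of_int (3 * \<bar>n\<bar> - 2) \<le> (of_int (n ^ 2) :: real)"
    by (simp only: of_int_le_iff)
  then have n2: "3 * \<bar>of_int n\<bar> - 2 \<le> (of_int n :: real) ^ 2" by simp
  have "k * (3 * \<bar>of_int n\<bar> - 2) \<le> k * of_int n ^ 2"
    using n2 assms by (intro mult_left_mono) auto
  moreover have "- (k * \<bar>of_int n\<bar>) \<le> s * of_int n"
  proof -
    have "\<bar>s * of_int n\<bar> \<le> k * \<bar>of_int n\<bar>"
      unfolding abs_mult using assms by (intro mult_right_mono) auto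
    then show ?thesis by linarith
  qed
  moreover have "1 * \<bar>of_int n\<bar> \<le> (2 * k) * \<bar>of_int n :: real\<bar>"
    using assms by (intro mult_right_mono) auto
  ultimately show ?thesis by (simp add: algebra_simps)
qed

section \<open>Powers of q and reciprocal q-factorials\<close>

text \<open>A nome \<open>q\<close> together with the \<open>\<tau>\<close> that fixes the branch of its real powers.\<close>
locale nome =
  fixes \<tau> q :: complex
  assumes Im_pos: "Im \<tau> > 0" and q_eq: "q = qpow \<tau> 1"
begin

text \<open>
  The real power \<open>q\<^sup>x\<close>.
\<close>
abbreviation Q :: "real \<Rightarrow> complex" where "Q \<equiv> qpow \<tau>"

text \<open>
  The reciprocal \<open>1 / (q)\<^sub>m\<close>, which is \<open>0\<close> for \<open>m < 0\<close>.
\<close>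
abbreviation ip :: "int \<Rightarrow> complex" where "ip \<equiv> inv_qpoch q"

lemma Q_add: "Q (x + y) = Q x * Q y"
  by (simp add: qpow_def flip: exp_add) (simp add: algebra_simps)

lemma Q_0 [simp]: "Q 0 = 1"
  by (simp add: qpow_def)

lemma Q_of_nat: "Q (real n) = q ^ n"
  by (induction n) (simp_all add: Q_add q_eq)

lemma Q_sum: "finite S \<Longrightarrow> Q (\<Sum>x\<in>S. h x) = (\<Prod>x\<in>S. Q (h x))"
  by (induction S rule: finite_induct) (simp_all add: Q_add)

lemma norm_Q: "norm (Q x) = exp (- (2 * pi * Im \<tau> * x))"
  by (simp add: qpow_def)

lemma norm_q_less_1: "norm q < 1"
  unfolding q_eq norm_Q using Im_pos by simp

lemma norm_Q_le: "norm (Q x) \<le> norm (Q y)" if "y \<le> x"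
  unfolding norm_Q using Im_pos that by (simp add: mult_left_mono)

lemma q_power_neq_1: "q ^ Suc n \<noteq> 1"
proof
  assume "q ^ Suc n = 1"
  then have "norm q ^ Suc n = 1" by (metis norm_one norm_power)
  then show False
    using power_less_one_iff[of "norm q" "Suc n"] norm_q_less_1 by simp
qed

lemma qpoch_Suc: "qpoch a q (Suc n) = qpoch a q n * (1 - a * q ^ n)"
  by (simp add: qpoch_def)

lemma qpoch_0 [simp]: "qpoch a q 0 = 1"
  by (simp add: qpoch_def)

lemma ip_neg [simp]: "m < 0 \<Longrightarrow> ip m = 0"
  by (simp add: inv_qpoch_def)

lemma ip_0 [simp]: "ip 0 = 1"
  by (simp add: inv_qpoch_def)

text \<open>
  The recurrence holds for all integers \<open>m\<close>, both sides being \<open>0\<close> for \<open>m \<le> 0\<close>. This makes the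
  summations below uniform in the sign of their parameters.
\<close>
lemma ip_rec: "(1 - Q (of_int m)) * ip m = ip (m - 1)"
proof (cases "m \<le> 0")
  case True
  then show ?thesis by (cases "m = 0") auto
next
  case False
  define n where "n = nat (m - 1)"
  have m: "m = int n + 1" using False by (simp add: n_def)
  have "Q (of_int m) = q ^ Suc n"
    using Q_of_nat[of "Suc n"] by (simp add: m add.commute)
  moreover have "ip m = 1 / qpoch q q (Suc n)" "ip (m - 1) = 1 / qpoch q q n"
    by (simp_all add: inv_qpoch_def m nat_add_distrib)
  ultimately show ?thesis
    using q_power_neq_1[of n] by (simp add: qpoch_Suc)
qed

section \<open>Two terminating q-hypergeometric sums\<close>

text \<open>
  A limiting case of the q-Chu-Vandermonde sum. The induction splits
  \<open>1 - q\<^bsup>n+1\<^esup> = (1 - q\<^bsup>n+1-s\<^esup>) + q\<^bsup>n+1-s\<^esup> (1 - q\<^sup>s)\<close>, which reduces the sum for \<open>(n + 1, m)\<close> to the sums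
  for \<open>(n, m)\<close> and \<open>(n, m + 1)\<close>.
\<close>
lemma q_Vandermonde:
  fixes m :: int
  shows "(\<Sum>s\<le>n. Q (real s ^ 2 + of_int m * real s) * (ip (int n - int s) * ip (int s)) * ip (int s + m))
    = ip (int n) * ip (int n + m)"
proof (induction n arbitrary: m)
  case 0
  then show ?case by simp
next
  case (Suc n)
  define t where "t n' m' s = Q (of_int s ^ 2 + of_int m' * of_int s) * (ip (n' - s) * ip s) * ip (s + m')"
    for n' m' s :: int
  have split: "(1 - Q (real (Suc n))) * t (int (Suc n)) m s
      = t (int n) m s + Q (real (Suc n) + of_int m) * t (int n) (m + 1) (s - 1)" for s
  proof -
    define x where "x = ip (int (Suc n) - s)"
    have x: "ip (int n - s) = (1 - Q (of_int (int (Suc n) - s))) * x"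
      unfolding x_def by (subst ip_rec) (simp add: algebra_simps)
    have y: "ip (s - 1) = (1 - Q (of_int s)) * ip s"
      by (simp add: ip_rec)
    have e: "Q (real (Suc n) + of_int m) * Q (of_int (s - 1) ^ 2 + of_int (m + 1) * of_int (s - 1))
        = Q (of_int (int (Suc n) - s)) * Q (of_int s ^ 2 + of_int m * of_int s)"
      unfolding Q_add[symmetric] by (rule arg_cong[of _ _ Q]) (simp add: power2_eq_square algebra_simps)
    have f: "Q (real (Suc n)) = Q (of_int (int (Suc n) - s)) * Q (of_int s)"
      unfolding Q_add[symmetric] by simp
    have i: "int n - (s - 1) = int (Suc n) - s" "s - 1 + (m + 1) = s + m" by simp_all
    have "t (int n) m s + Q (real (Suc n) + of_int m) * t (int n) (m + 1) (s - 1)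
      = t (int n) m s + (Q (real (Suc n) + of_int m) * Q (of_int (s - 1) ^ 2 + of_int (m + 1) * of_int (s - 1)))
          * (x * ip (s - 1)) * ip (s + m)"
      unfolding t_def i x_def by (simp only: mult.assoc)
    also have "\<dots> = (1 - Q (real (Suc n))) * t (int (Suc n)) m s"
      unfolding e t_def f x y x_def[symmetric] by (simp only: algebra_simps mult_1_left)
    finally show ?thesis by simp
  qed
  have IH: "(\<Sum>s\<le>n. t (int n) m' (int s)) = ip (int n) * ip (int n + m')" for m'
    using Suc.IH[of m'] by (simp add: t_def)
  have "(1 - Q (real (Suc n))) * (\<Sum>s\<le>Suc n. t (int (Suc n)) m (int s))
      = (\<Sum>s\<le>Suc n. t (int n) m (int s))
        + Q (real (Suc n) + of_int m) * (\<Sum>s\<le>Suc n. t (int n) (m + 1) (int s - 1))"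
    unfolding sum_distrib_left split sum.distrib ..
  also have "(\<Sum>s\<le>Suc n. t (int n) m (int s)) = (\<Sum>s\<le>n. t (int n) m (int s))"
    by (simp add: t_def)
  also have "(\<Sum>s\<le>Suc n. t (int n) (m + 1) (int s - 1)) = (\<Sum>s\<le>n. t (int n) (m + 1) (int s))"
    by (subst sum.atMost_Suc_shift) (simp add: t_def)
  also have "(\<Sum>s\<le>n. t (int n) m (int s)) + Q (real (Suc n) + of_int m) * (\<Sum>s\<le>n. t (int n) (m + 1) (int s))
     = ip (int n) * (ip (int (Suc n) + m - 1) + Q (of_int (int (Suc n) + m)) * ip (int (Suc n) + m))"
    unfolding IH by (simp add: algebra_simps)
  also have "\<dots> = ip (int n) * ip (int (Suc n) + m)"
    unfolding ip_rec[symmetric] by (simp add: algebra_simps)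
  also have "\<dots> = (1 - Q (real (Suc n))) * (ip (int (Suc n)) * ip (int (Suc n) + m))"
    using ip_rec[of "int (Suc n)"] by simp
  finally have "(\<Sum>s\<le>Suc n. t (int (Suc n)) m (int s)) = ip (int (Suc n)) * ip (int (Suc n) + m)"
    using q_power_neq_1[of n] unfolding Q_of_nat by (simp del: sum.atMost_Suc)
  then show ?case by (simp add: t_def del: sum.atMost_Suc)
qed

text \<open>
  The q-Chu-Vandermonde sum that tends to the q-Gauss sum
  \<open>\<Sum>\<^sub>s (a)\<^sub>s q\<^bsup>s(s-1)/2\<^esup> (-c/a)\<^sup>s / ((q)\<^sub>s (c)\<^sub>s) = (c/a)\<^sub>\<infinity> / (c)\<^sub>\<infinity>\<close> as \<open>n \<rightarrow> \<infinity>\<close>, for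
  \<open>a = -q\<^bsup>u+1\<^esup>\<close> and \<open>c = q\<^bsup>u+d+1\<^esup>\<close>. The induction splits \<open>1 - q\<^bsup>n+1\<^esup>\<close> as in
  \<open>q_Vandermonde\<close>, shifting \<open>u\<close> at fixed \<open>d\<close>.
\<close>
lemma q_Gauss:
  fixes u d :: nat
  shows "(\<Sum>s\<le>n. Q (real s * (real s - 1) / 2 + real d * real s) * qpoch (-q) q (u + s)
      * (ip (int n - int s) * ip (int s)) * ip (int s + int (u + d)))
    = qpoch (- Q d) q n * qpoch (-q) q u * (ip (int n) * ip (int n + int (u + d)))"
proof (induction n arbitrary: u)
  case 0
  then show ?case by simp
next
  case (Suc n)
  define t where "t n' u' s = Q (of_int s * (of_int s - 1) / 2 + real d * of_int s) * qpoch (-q) q (nat (u' + s))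
      * (ip (n' - s) * ip s) * ip (s + u' + int d)"
    for n' u' s :: int
  have split: "(1 - Q (real (Suc n))) * t (int (Suc n)) u' s
      = t (int n) u' s + Q (real n + real d) * t (int n) (u' + 1) (s - 1)" for s u'
  proof -
    define x where "x = ip (int (Suc n) - s)"
    have x: "ip (int n - s) = (1 - Q (of_int (int (Suc n) - s))) * x"
      unfolding x_def by (subst ip_rec) (simp add: algebra_simps)
    have y: "ip (s - 1) = (1 - Q (of_int s)) * ip s"
      by (simp add: ip_rec)
    have e: "Q (real n + real d) * Q (of_int (s - 1) * (of_int (s - 1) - 1) / 2 + real d * of_int (s - 1))
        = Q (of_int (int (Suc n) - s)) * Q (of_int s * (of_int s - 1) / 2 + real d * of_int s)"
      unfolding Q_add[symmetric] by (rule arg_cong[of _ _ Q]) (simp add: field_simps)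
    have f: "Q (real (Suc n)) = Q (of_int (int (Suc n) - s)) * Q (of_int s)"
      unfolding Q_add[symmetric] by simp
    have i: "int n - (s - 1) = int (Suc n) - s" "s - 1 + (u' + 1) + int d = s + u' + int d"
        "u' + 1 + (s - 1) = u' + s" by simp_all
    have "t (int n) u' s + Q (real n + real d) * t (int n) (u' + 1) (s - 1)
      = t (int n) u' s + (Q (real n + real d) * Q (of_int (s - 1) * (of_int (s - 1) - 1) / 2 + real d * of_int (s - 1)))
          * qpoch (-q) q (nat (u' + s)) * (x * ip (s - 1)) * ip (s + u' + int d)"
      unfolding t_def i x_def by (simp only: mult.assoc)
    also have "\<dots> = (1 - Q (real (Suc n))) * t (int (Suc n)) u' s"
      unfolding e t_def f x y x_def[symmetric] by (simp only: algebra_simps mult_1_left)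
    finally show ?thesis by simp
  qed
  have IH: "(\<Sum>s\<le>n. t (int n) (int u') (int s)) =
      qpoch (- Q d) q n * qpoch (-q) q u' * (ip (int n) * ip (int n + int u' + int d))" for u'
    using Suc.IH[of u'] by (simp add: t_def nat_add_distrib algebra_simps)
  define z where "z = ip (int (Suc n) + int u + int d)"
  have z: "ip (int n + int u + int d) = (1 - Q (of_int (int (Suc n) + int u + int d))) * z"
    unfolding z_def by (subst ip_rec) (simp add: algebra_simps)
  have ud: "Q (of_int (int (Suc n) + int u + int d)) = q ^ n * Q d * q * q ^ u"
    using Q_of_nat[of "n + d + Suc u"] Q_of_nat[of d]
    by (simp add: power_add algebra_simps)
  have nd: "Q (real n + real d) = q ^ n * Q d"
    by (simp add: Q_add Q_of_nat)
  have "(1 - Q (real (Suc n))) * (\<Sum>s\<le>Suc n. t (int (Suc n)) (int u) (int s))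
      = (\<Sum>s\<le>Suc n. t (int n) (int u) (int s))
        + Q (real n + real d) * (\<Sum>s\<le>Suc n. t (int n) (int u + 1) (int s - 1))"
    unfolding sum_distrib_left split sum.distrib ..
  also have "(\<Sum>s\<le>Suc n. t (int n) (int u) (int s)) = (\<Sum>s\<le>n. t (int n) (int u) (int s))"
    by (simp add: t_def)
  also have "(\<Sum>s\<le>Suc n. t (int n) (int u + 1) (int s - 1)) = (\<Sum>s\<le>n. t (int n) (int (Suc u)) (int s))"
    by (subst sum.atMost_Suc_shift) (simp add: t_def add.commute)
  also have "(\<Sum>s\<le>n. t (int n) (int u) (int s)) + Q (real n + real d) * (\<Sum>s\<le>n. t (int n) (int (Suc u)) (int s))
     = qpoch (- Q d) q n * ip (int n) *
        (qpoch (-q) q u * ip (int n + int u + int d) + Q (real n + real d) * (qpoch (-q) q (Suc u) * z))"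
    unfolding IH z_def by (simp add: algebra_simps)
  also have "\<dots> = qpoch (- Q d) q (Suc n) * qpoch (-q) q u * ip (int n) * z"
    unfolding z ud nd qpoch_Suc by (simp add: algebra_simps)
  also have "\<dots> = (1 - Q (real (Suc n))) * (qpoch (- Q d) q (Suc n) * qpoch (-q) q u * (ip (int (Suc n)) * z))"
    using ip_rec[of "int (Suc n)"] by simp
  finally have "(\<Sum>s\<le>Suc n. t (int (Suc n)) (int u) (int s))
      = qpoch (- Q d) q (Suc n) * qpoch (-q) q u * (ip (int (Suc n)) * z)"
    using q_power_neq_1[of n] unfolding Q_of_nat by (simp del: sum.atMost_Suc)
  then show ?case by (simp add: t_def z_def nat_add_distrib add.assoc del: sum.atMost_Suc)
qed

section \<open>Kernels of Bailey pairs\<close>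

text \<open>
  The kernel of Bailey pairs relative to \<open>1\<close>; it vanishes unless \<open>|r| \<le> M\<close>.
\<close>
definition A :: "int \<Rightarrow> int \<Rightarrow> complex" where
  "A r M = ip (M - r) * ip (M + r)"

text \<open>
  The kernel of Bailey pairs relative to \<open>q\<close>, without the customary factor \<open>1 - q\<close>.
\<close>
definition B :: "int \<Rightarrow> int \<Rightarrow> complex" where
  "B r M = ip (M - r) * ip (M + r + 1)"

lemma A_abs: "A \<bar>r\<bar> M = A r M"
  by (simp add: A_def abs_if)

lemma A_eq_0: "M < r \<Longrightarrow> A r M = 0"
  by (simp add: A_def)

lemma B_to_A: "(1 - Q (2 * of_int r + 1)) * B r M = A r M - Q (2 * of_int r + 1) * A (r + 1) M"
proof -
  have a: "A r M = (1 - Q (of_int (M + r + 1))) * B r M"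
    using ip_rec[of "M + r + 1"] by (simp add: A_def B_def)
  have b: "A (r + 1) M = (1 - Q (of_int (M - r))) * B r M"
    using ip_rec[of "M - r"] by (simp add: A_def B_def diff_diff_eq add.assoc mult.assoc[symmetric])
  have c: "Q (of_int (M + r + 1)) = Q (2 * of_int r + 1) * Q (of_int (M - r))"
    unfolding Q_add[symmetric] by (simp add: add_ac)
  show ?thesis unfolding a b c by (simp add: algebra_simps)
qed

text \<open>
  The pair whose only nonzero entry sits at \<open>l\<close>, rewritten relative to \<open>q\<close>. For \<open>R \<ge> M\<close> the sum
  over \<open>r\<close> telescopes.
\<close>
lemma unit_expansion:
  assumes "M \<le> int R"
  shows "A l M = (\<Sum>r=nat \<bar>l\<bar>..R. Q (real r ^ 2 - of_int l ^ 2) * ((1 - Q (2 * real r + 1)) * B (int r) M))"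
    (is "_ = sum ?g _")
proof (cases "nat \<bar>l\<bar> \<le> R")
  case True
  define F where "F r = - (Q (real r ^ 2 - of_int l ^ 2) * A (int r) M)" for r
  have "?g r = F (Suc r) - F r" for r
  proof -
    have e: "Q (real (Suc r) ^ 2 - of_int l ^ 2) = Q (real r ^ 2 - of_int l ^ 2) * Q (2 * real r + 1)"
      unfolding Q_add[symmetric] by (rule arg_cong[of _ _ Q]) (simp add: power2_eq_square algebra_simps)
    have b: "(1 - Q (2 * real r + 1)) * B (int r) M = A (int r) M - Q (2 * real r + 1) * A (int (Suc r)) M"
      using B_to_A[of "int r" M] by (simp add: add.commute)
    show ?thesis unfolding F_def e b by (simp add: algebra_simps)
  qed
  then have "sum ?g {nat \<bar>l\<bar>..R} = F (Suc R) - F (nat \<bar>l\<bar>)"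
    using True by (simp add: sum_Suc_diff)
  also have "\<dots> = A l M"
    using assms by (simp add: F_def A_eq_0 A_abs)
  finally show ?thesis ..
next
  case False
  then have "M < \<bar>l\<bar>" using assms by linarith
  then have "A l M = 0" using A_eq_0 A_abs by metis
  then show ?thesis using False by simp
qed

text \<open>
  The factors \<open>ip (L - M)\<close> and \<open>ip (M - r)\<close> cut a sum over \<open>M\<close> down to \<open>r \<le> M \<le> L\<close>; with
  \<open>M = r + s\<close> it takes the shape of the sums above.
\<close>
lemma sum_shift:
  assumes "finite S" "{r..L} \<subseteq> S"
  shows "(\<Sum>M\<in>S. ip (L - M) * (h M * (ip (M - r) * z M)))
    = (if L < r then 0
       else \<Sum>s\<le>nat (L - r). h (r + int s) * (ip (int (nat (L - r)) - int s) * ip (int s)) * z (r + int s))"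
proof -
  have "(\<Sum>M\<in>S. ip (L - M) * (h M * (ip (M - r) * z M)))
      = (\<Sum>M\<in>{r..L}. ip (L - M) * (h M * (ip (M - r) * z M)))"
    using assms by (intro sum.mono_neutral_right) (auto simp: not_le)
  also have "\<dots> = (if L < r then 0 else \<Sum>s\<le>nat (L - r). h (r + int s) * (ip (int (nat (L - r)) - int s) * ip (int s)) * z (r + int s))"
  proof (cases "L < r")
    case False
    have "(\<Sum>M\<in>{r..L}. ip (L - M) * (h M * (ip (M - r) * z M)))
      = (\<Sum>s\<le>nat (L - r). ip (L - (r + int s)) * (h (r + int s) * (ip (int s) * z (r + int s))))"
      by (rule sum.reindex_bij_witness[of _ "\<lambda>s. r + int s" "\<lambda>M. nat (M - r)"]) (use False in auto)
    also have "\<dots> = (\<Sum>s\<le>nat (L - r). h (r + int s) * (ip (int (nat (L - r)) - int s) * ip (int s)) * z (r + int s))"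
      using False by (intro sum.cong) (simp_all add: mult_ac diff_diff_eq)
    finally show ?thesis using False by simp
  qed simp
  finally show ?thesis .
qed

text \<open>
  Bailey's lemma relative to \<open>1\<close>; the constant \<open>c\<close> only normalises the exponent.
\<close>
lemma Bailey_step_A:
  assumes "finite S" "{int r..L} \<subseteq> S"
  shows "(\<Sum>M\<in>S. ip (L - M) * (Q (of_int M ^ 2 - c) * A (int r) M)) = Q (real r ^ 2 - c) * A (int r) L"
proof (cases "L < int r")
  case True
  then show ?thesis unfolding A_def using sum_shift[OF assms] by simp
next
  case False
  define n where "n = nat (L - int r)"
  have L: "L = int r + int n" using False by (simp add: n_def)
  have e: "Q (of_int (int r + int s) ^ 2 - c) = Q (real r ^ 2 - c) * Q (real s ^ 2 + of_int (2 * int r) * real s)" for s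
    unfolding Q_add[symmetric] by (rule arg_cong[of _ _ Q]) (simp add: power2_eq_square algebra_simps)
  have i: "int r + int s + int r = int s + 2 * int r" for s by simp
  have "(\<Sum>M\<in>S. ip (L - M) * (Q (of_int M ^ 2 - c) * A (int r) M))
    = Q (real r ^ 2 - c) * (\<Sum>s\<le>n. Q (real s ^ 2 + of_int (2 * int r) * real s) * (ip (int n - int s) * ip (int s)) * ip (int s + 2 * int r))"
    unfolding A_def sum_shift[OF assms] sum_distrib_left n_def[symmetric] e i using False by (simp only: mult.assoc if_False)
  also have "\<dots> = Q (real r ^ 2 - c) * A (int r) L"
    unfolding q_Vandermonde by (simp add: A_def L algebra_simps)
  finally show ?thesis .
qed

lemma Bailey_step_B:
  assumes "finite S" "{int r..L} \<subseteq> S"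
  shows "(\<Sum>M\<in>S. ip (L - M) * (Q (of_int M ^ 2 + of_int M - c) * B (int r) M)) = Q (real r ^ 2 + real r - c) * B (int r) L"
proof (cases "L < int r")
  case True
  then show ?thesis unfolding B_def using sum_shift[OF assms] by simp
next
  case False
  define n where "n = nat (L - int r)"
  have L: "L = int r + int n" using False by (simp add: n_def)
  have e: "Q (of_int (int r + int s) ^ 2 + of_int (int r + int s) - c)
      = Q (real r ^ 2 + real r - c) * Q (real s ^ 2 + of_int (2 * int r + 1) * real s)" for s
    unfolding Q_add[symmetric] by (rule arg_cong[of _ _ Q]) (simp add: power2_eq_square algebra_simps)
  have i: "int r + int s + int r + 1 = int s + (2 * int r + 1)" for s by simp
  have "(\<Sum>M\<in>S. ip (L - M) * (Q (of_int M ^ 2 + of_int M - c) * B (int r) M))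
    = Q (real r ^ 2 + real r - c) * (\<Sum>s\<le>n. Q (real s ^ 2 + of_int (2 * int r + 1) * real s) * (ip (int n - int s) * ip (int s)) * ip (int s + (2 * int r + 1)))"
    unfolding B_def sum_shift[OF assms] sum_distrib_left n_def[symmetric] e i using False by (simp only: mult.assoc if_False)
  also have "\<dots> = Q (real r ^ 2 + real r - c) * B (int r) L"
    unfolding q_Vandermonde by (simp add: B_def L algebra_simps)
  finally show ?thesis .
qed

lemma qpoch_append: "qpoch (- q) q r * qpoch (- Q (real (Suc r))) q n = qpoch (-q) q (r + n)"
proof (induction n)
  case (Suc n)
  have "- Q (real (Suc r)) * q ^ n = - q * q ^ (r + n)"
    by (simp only: Q_of_nat) (simp add: power_add)
  then show ?case using Suc unfolding qpoch_Suc add_Suc_right by (metis mult.assoc)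
qed simp

lemma qpoch_append_pred: "qpoch (- q) q r * qpoch (- Q (real r)) q n = (1 + Q (real r)) * qpoch (-q) q (r + n - 1)"
  if "1 \<le> r + n"
proof (cases n)
  case 0
  then obtain r' where "r = Suc r'" using \<open>1 \<le> r + n\<close> by (cases r) auto
  with 0 show ?thesis using Q_of_nat[of r] by (simp add: qpoch_Suc)
next
  case (Suc n')
  have "qpoch (- Q (real r)) q (Suc n'') = (1 + Q (real r)) * qpoch (- Q (real (Suc r))) q n''" for n''
  proof (induction n'')
    case (Suc n'')
    have "- Q (real r) * q ^ Suc n'' = - Q (real (Suc r)) * q ^ n''"
      by (simp only: Q_of_nat) simp
    then show ?case using Suc unfolding qpoch_Suc[of _ "Suc n''"] qpoch_Suc[of _ n''] by (simp add: mult.assoc)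
  qed (simp add: qpoch_Suc)
  then show ?thesis using qpoch_append[of r n'] Suc by (simp add: mult_ac)
qed

text \<open>
  Bailey's lemma for the weight with the factor \<open>(-q)\<^sub>M\<close>. The hypothesis \<open>1 \<le> L\<close> keeps the index
  \<open>L - 1\<close> meaningful.
\<close>
lemma final_step_A:
  assumes "finite S" "{int r..L} \<subseteq> S" "1 \<le> L"
  shows "(\<Sum>M\<in>S. ip (L - M) * (Q ((of_int M ^ 2 - of_int M) / 2 - c) * qpoch (-q) q (nat M) * A (int r) M))
    = Q ((real r ^ 2 - real r) / 2 - c) * (1 + Q (real r)) * qpoch (-q) q (nat L - 1) * A (int r) L"
proof (cases "L < int r")
  case True
  then show ?thesis unfolding A_def using sum_shift[OF assms(1,2)] by simp
next
  case False
  define n where "n = nat (L - int r)"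
  have L: "L = int r + int n" using False by (simp add: n_def)
  then have nL: "nat L = r + n" by simp
  have e: "Q ((of_int (int r + int s) ^ 2 - of_int (int r + int s)) / 2 - c)
      = Q ((real r ^ 2 - real r) / 2 - c) * Q (real s * (real s - 1) / 2 + real r * real s)" for s
    unfolding Q_add[symmetric] by (rule arg_cong[of _ _ Q]) (simp add: power2_eq_square field_simps)
  have i: "int r + int s + int r = int s + int (r + r)" "nat (int r + int s) = r + s" for s by simp_all
  have "(\<Sum>M\<in>S. ip (L - M) * (Q ((of_int M ^ 2 - of_int M) / 2 - c) * qpoch (-q) q (nat M) * A (int r) M))
    = Q ((real r ^ 2 - real r) / 2 - c) * (\<Sum>s\<le>n. Q (real s * (real s - 1) / 2 + real r * real s) * qpoch (-q) q (r + s)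
      * (ip (int n - int s) * ip (int s)) * ip (int s + int (r + r)))"
    unfolding A_def sum_shift[OF assms(1,2)] sum_distrib_left n_def[symmetric] e i using False by (simp only: mult.assoc if_False)
  also have "\<dots> = Q ((real r ^ 2 - real r) / 2 - c) * ((qpoch (-q) q r * qpoch (- Q (real r)) q n) * A (int r) L)"
    unfolding q_Gauss by (simp add: A_def L algebra_simps)
  also have "qpoch (-q) q r * qpoch (- Q (real r)) q n = (1 + Q (real r)) * qpoch (-q) q (nat L - 1)"
    unfolding nL using assms(3) L by (intro qpoch_append_pred) simp
  finally show ?thesis by (simp only: mult.assoc)
qed

lemma final_step_B:
  assumes "finite S" "{int r..L} \<subseteq> S"
  shows "(\<Sum>M\<in>S. ip (L - M) * (Q ((of_int M ^ 2 + of_int M) / 2 - c) * qpoch (-q) q (nat M) * B (int r) M))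
    = Q ((real r ^ 2 + real r) / 2 - c) * qpoch (-q) q (nat L) * B (int r) L"
proof (cases "L < int r")
  case True
  then show ?thesis unfolding B_def using sum_shift[OF assms(1,2)] by simp
next
  case False
  define n where "n = nat (L - int r)"
  have L: "L = int r + int n" using False by (simp add: n_def)
  then have nL: "nat L = r + n" by simp
  have e: "Q ((of_int (int r + int s) ^ 2 + of_int (int r + int s)) / 2 - c)
      = Q ((real r ^ 2 + real r) / 2 - c) * Q (real s * (real s - 1) / 2 + real (Suc r) * real s)" for s
    unfolding Q_add[symmetric] by (rule arg_cong[of _ _ Q]) (simp add: power2_eq_square field_simps)
  have i: "int r + int s + int r + 1 = int s + int (r + Suc r)" "nat (int r + int s) = r + s" for s by simp_all
  have "(\<Sum>M\<in>S. ip (L - M) * (Q ((of_int M ^ 2 + of_int M) / 2 - c) * qpoch (-q) q (nat M) * B (int r) M))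
    = Q ((real r ^ 2 + real r) / 2 - c) * (\<Sum>s\<le>n. Q (real s * (real s - 1) / 2 + real (Suc r) * real s) * qpoch (-q) q (r + s)
      * (ip (int n - int s) * ip (int s)) * ip (int s + int (r + Suc r)))"
    unfolding B_def sum_shift[OF assms(1,2)] sum_distrib_left n_def[symmetric] e i using False by (simp only: mult.assoc if_False)
  also have "\<dots> = Q ((real r ^ 2 + real r) / 2 - c) * ((qpoch (-q) q r * qpoch (- Q (real (Suc r))) q n) * B (int r) L)"
    unfolding q_Gauss by (simp add: B_def L algebra_simps)
  also have "qpoch (-q) q r * qpoch (- Q (real (Suc r))) q n = qpoch (-q) q (nat L)"
    unfolding nL qpoch_append ..
  finally show ?thesis by (simp only: mult.assoc)
qed

section \<open>The Bailey chain as a multiple sum\<close>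

text \<open>
  The \<open>j\<close>-fold Bailey chain that starts from \<open>A\<^sub>l\<close> and uses the weights \<open>w\<^sub>k, w\<^bsub>k-1\<^esub>, \<dots>\<close> in this
  order, as a function of its upper limit \<open>L\<close>. The bound \<open>b\<close> makes every sum finite; it has no influence on
  the values at \<open>L \<le> l + b\<close>.
\<close>
primrec chain :: "(nat \<Rightarrow> int \<Rightarrow> complex) \<Rightarrow> nat \<Rightarrow> int \<Rightarrow> nat \<Rightarrow> nat \<Rightarrow> int \<Rightarrow> complex" where
  "chain w k l b 0 L = A l L"
| "chain w k l b (Suc j) L = (\<Sum>M\<in>{l..l + int b}. ip (L - M) * (w (k - j) M * chain w k l b j M))"

text \<open>
  The part of the summand of the multiple series that involves \<open>n\<^sub>a, \<dots>, n\<^sub>k\<close>, for general weights \<open>w\<^sub>j\<close>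
  evaluated at \<open>M\<^sub>j = N\<^sub>j + l\<close>.
\<close>
definition tuple_term :: "(nat \<Rightarrow> int \<Rightarrow> complex) \<Rightarrow> nat \<Rightarrow> int \<Rightarrow> nat \<Rightarrow> (nat \<Rightarrow> nat) \<Rightarrow> complex" where
  "tuple_term w k l a n =
     (\<Prod>j=a..k. w j (int (tail_sum k n j) + l) * ip (int (n j))) * ip (int (n k) + 2 * l)"

lemma shift_range:
  assumes "L \<le> l + int b"
  shows "(\<Sum>x\<le>b. ip (L - (l + int (x + N))) * (h (int (x + N) + l) * ip (int x)))
    = (\<Sum>M\<in>{l..l + int b}. ip (L - M) * (h M * ip (M - (l + int N))))"
proof -
  have "(\<Sum>x\<le>b. ip (L - (l + int (x + N))) * (h (int (x + N) + l) * ip (int x)))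
    = (\<Sum>M\<in>{l + int N..l + int N + int b}. ip (L - M) * (h M * ip (M - (l + int N))))"
    by (rule sum.reindex_bij_witness[of _ "\<lambda>M. nat (M - (l + int N))" "\<lambda>x. l + int (x + N)"])
      (auto simp: algebra_simps)
  also have "\<dots> = (\<Sum>M\<in>{l + int N..l + int b}. ip (L - M) * (h M * ip (M - (l + int N))))"
    using assms by (intro sum.mono_neutral_right) auto
  also have "\<dots> = (\<Sum>M\<in>{l..l + int b}. ip (L - M) * (h M * ip (M - (l + int N))))"
    by (intro sum.mono_neutral_left) auto
  finally show ?thesis .
qed

text \<open>
  Passing from \<open>(M\<^sub>a, \<dots>, M\<^sub>k)\<close> to the differences \<open>n\<^sub>j = M\<^sub>j - M\<^bsub>j+1\<^esub>\<close> and \<open>n\<^sub>k = M\<^sub>k - l\<close>.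
\<close>
lemma chain_eq_tuple_sum:
  assumes "j < k" "L \<le> l + int b"
  shows "chain w k l b (Suc j) L =
    (\<Sum>n\<in>PiE {k - j..k} (\<lambda>_. {..b}). ip (L - (l + int (tail_sum k n (k - j)))) * tuple_term w k l (k - j) n)"
  using assms
proof (induction j arbitrary: L)
  case 0
  have s: "{k..k} = insert k {}" by simp
  have "(\<Sum>n\<in>PiE {k..k} (\<lambda>_. {..b}). ip (L - (l + int (tail_sum k n k))) * tuple_term w k l k n)
    = (\<Sum>x\<le>b. ip (L - (l + int (x + 0))) * ((w k (int (x + 0) + l) * ip (int (x + 0) + l - l + 2 * l)) * ip (int x)))"
    unfolding s by (subst sum_PiE_insert) (simp_all add: tuple_term_def tail_sum_def mult_ac)
  also have "\<dots> = (\<Sum>M\<in>{l..l + int b}. ip (L - M) * ((w k M * ip (M - l + 2 * l)) * ip (M - (l + int 0))))"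
    using shift_range[OF 0(2), where N = 0 and h = "\<lambda>M. w k M * ip (M - l + 2 * l)"] .
  also have "\<dots> = chain w k l b (Suc 0) L"
    by (simp add: A_def mult_ac add.commute)
  finally show ?case by simp
next
  case (Suc j)
  define a where "a = k - Suc j"
  have a: "a < k" "k - j = Suc a" and s: "{a..k} = insert a {Suc a..k}" and na: "a \<notin> {Suc a..k}"
    using Suc.prems by (auto simp: a_def)
  have t: "tuple_term w k l a (n(a := x)) =
      w a (int (x + tail_sum k n (Suc a)) + l) * ip (int x) * tuple_term w k l (Suc a) n" for n x
  proof -
    have "(\<Prod>j\<in>{Suc a..k}. w j (int (tail_sum k (n(a := x)) j) + l) * ip (int ((n(a := x)) j)))
       = (\<Prod>j\<in>{Suc a..k}. w j (int (tail_sum k n j) + l) * ip (int (n j)))"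
      by (intro prod.cong) (auto simp: tail_sum_upd)
    then show ?thesis
      using a by (simp add: tuple_term_def s tail_sum_split[of a k "n(a := x)"] tail_sum_upd mult_ac)
  qed
  have "(\<Sum>n\<in>PiE {a..k} (\<lambda>_. {..b}). ip (L - (l + int (tail_sum k n a))) * tuple_term w k l a n)
    = (\<Sum>n\<in>PiE {Suc a..k} (\<lambda>_. {..b}). \<Sum>x\<le>b.
        ip (L - (l + int (x + tail_sum k n (Suc a)))) * (w a (int (x + tail_sum k n (Suc a)) + l) * ip (int x))
          * tuple_term w k l (Suc a) n)"
    unfolding s sum_PiE_insert[OF na] t
    using a by (intro sum.cong refl) (simp add: tail_sum_split[of a k "_(a := _)"] tail_sum_upd mult.assoc)
  also have "\<dots> = (\<Sum>n\<in>PiE {Suc a..k} (\<lambda>_. {..b}). (\<Sum>M\<in>{l..l + int b}.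
        ip (L - M) * (w a M * ip (M - (l + int (tail_sum k n (Suc a)))))) * tuple_term w k l (Suc a) n)"
    unfolding sum_distrib_right[symmetric] shift_range[OF Suc.prems(2)] ..
  also have "\<dots> = (\<Sum>M\<in>{l..l + int b}. ip (L - M) * (w a M *
        (\<Sum>n\<in>PiE {Suc a..k} (\<lambda>_. {..b}). ip (M - (l + int (tail_sum k n (Suc a)))) * tuple_term w k l (Suc a) n)))"
    unfolding sum_distrib_left sum_distrib_right by (subst sum.swap) (simp add: mult_ac)
  also have "\<dots> = (\<Sum>M\<in>{l..l + int b}. ip (L - M) * (w a M * chain w k l b (Suc j) M))"
    using Suc.prems(1) by (intro sum.cong refl) (simp del: chain.simps add: Suc.IH a)
  also have "\<dots> = chain w k l b (Suc (Suc j)) L"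
    by (simp only: chain.simps(2)[of _ _ _ _ "Suc j"] a_def)
  finally show ?case by (simp only: a_def)
qed

lemma chain_step:
  assumes "\<And>M. M \<le> l + int b \<Longrightarrow> chain w k l b j M = (\<Sum>r\<in>T. c r * X r M)"
    and "\<And>r. r \<in> T \<Longrightarrow> (\<Sum>M\<in>{l..l + int b}. ip (L - M) * (w (k - j) M * X r M)) = d r * X' r"
  shows "chain w k l b (Suc j) L = (\<Sum>r\<in>T. c r * (d r * X' r))"
proof -
  have "chain w k l b (Suc j) L = (\<Sum>M\<in>{l..l + int b}. ip (L - M) * (w (k - j) M * (\<Sum>r\<in>T. c r * X r M)))"
    using assms(1) by simp
  also have "\<dots> = (\<Sum>r\<in>T. c r * (\<Sum>M\<in>{l..l + int b}. ip (L - M) * (w (k - j) M * X r M)))"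
    unfolding sum_distrib_left by (subst sum.swap) (simp add: mult_ac)
  also have "\<dots> = (\<Sum>r\<in>T. c r * (d r * X' r))"
    by (intro sum.cong refl) (simp add: assms(2))
  finally show ?thesis .
qed

text \<open>
  As long as all weights are \<open>q\<^bsup>M\<^sup>2 + M - l\<^sup>2 - l\<^esup>\<close>, the chain stays a combination of the \<open>B\<^sub>r\<close>.
\<close>
lemma chain_B:
  assumes "\<And>j M. j < J \<Longrightarrow> w (k - j) M = Q (of_int M ^ 2 + of_int M - (of_int l ^ 2 + of_int l))"
    and "L \<le> l + int b" "l + int b \<le> int R" "j \<le> J"
  shows "chain w k l b j L = (\<Sum>r=nat \<bar>l\<bar>..R.
      (Q (real r ^ 2 - of_int l ^ 2 + real j * (real r ^ 2 + real r - (of_int l ^ 2 + of_int l)))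
        * (1 - Q (2 * real r + 1))) * B (int r) L)"
  using assms(2,4)
proof (induction j arbitrary: L)
  case 0
  then show ?case using unit_expansion[of L R l] assms(3) by (simp add: mult.assoc)
next
  case (Suc j)
  have "chain w k l b (Suc j) L = (\<Sum>r=nat \<bar>l\<bar>..R.
      (Q (real r ^ 2 - of_int l ^ 2 + real j * (real r ^ 2 + real r - (of_int l ^ 2 + of_int l)))
        * (1 - Q (2 * real r + 1))) * (Q (real r ^ 2 + real r - (of_int l ^ 2 + of_int l)) * B (int r) L))"
  proof (rule chain_step)
    show "(\<Sum>M\<in>{l..l + int b}. ip (L - M) * (w (k - j) M * B (int r) M)) =
         Q ((real r)\<^sup>2 + real r - (of_int l ^ 2 + of_int l)) * B (int r) L"
      if "r \<in> {nat \<bar>l\<bar>..R}" for r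
      unfolding assms(1)[OF Suc_le_lessD[OF Suc.prems(2)]]
      using that Suc.prems by (intro Bailey_step_B) auto
  qed (use Suc in auto)
  also have "\<dots> = (\<Sum>r=nat \<bar>l\<bar>..R.
      (Q (real r ^ 2 - of_int l ^ 2 + real (Suc j) * (real r ^ 2 + real r - (of_int l ^ 2 + of_int l)))
        * (1 - Q (2 * real r + 1))) * B (int r) L)"
  proof (intro sum.cong refl)
    fix r
    have "real r ^ 2 - of_int l ^ 2 + real (Suc j) * (real r ^ 2 + real r - (of_int l ^ 2 + of_int l))
      = (real r ^ 2 - of_int l ^ 2 + real j * (real r ^ 2 + real r - (of_int l ^ 2 + of_int l)))
         + (real r ^ 2 + real r - (of_int l ^ 2 + of_int l))" by (simp add: algebra_simps)
    then show "(Q (real r ^ 2 - of_int l ^ 2 + real j * (real r ^ 2 + real r - (of_int l ^ 2 + of_int l)))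
        * (1 - Q (2 * real r + 1))) * (Q (real r ^ 2 + real r - (of_int l ^ 2 + of_int l)) * B (int r) L)
       = (Q (real r ^ 2 - of_int l ^ 2 + real (Suc j) * (real r ^ 2 + real r - (of_int l ^ 2 + of_int l)))
        * (1 - Q (2 * real r + 1))) * B (int r) L"
      by (simp only: Q_add mult_ac)
  qed
  finally show ?case .
qed

text \<open>
  After \<open>J\<close> steps with weight \<open>q\<^bsup>M\<^sup>2 + M - l\<^sup>2 - l\<^esup>\<close>, each \<open>(1 - q\<^bsup>2r+1\<^esup>) B\<^sub>r\<close> is replaced by
  \<open>A\<^sub>r - q\<^bsup>2r+1\<^esup> A\<^bsub>r+1\<^esub>\<close>, and \<open>m\<close> steps with weight \<open>q\<^bsup>M\<^sup>2 - l\<^sup>2\<^esup>\<close> follow.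
\<close>
lemma chain_A:
  assumes "\<And>j M. j < J \<Longrightarrow> w (k - j) M = Q (of_int M ^ 2 + of_int M - (of_int l ^ 2 + of_int l))"
    and "\<And>j M. J \<le> j \<Longrightarrow> j < J' \<Longrightarrow> w (k - j) M = Q (of_int M ^ 2 - of_int l ^ 2)"
    and "L \<le> l + int b" "l + int b \<le> int R" "J + m \<le> J'"
  shows "chain w k l b (J + m) L = (\<Sum>r=nat \<bar>l\<bar>..R.
      Q (real r ^ 2 - of_int l ^ 2 + real J * (real r ^ 2 + real r - (of_int l ^ 2 + of_int l)))
        * (Q (real m * (real r ^ 2 - of_int l ^ 2)) * A (int r) L
            - Q (2 * real r + 1) * Q (real m * (real (Suc r) ^ 2 - of_int l ^ 2)) * A (int (Suc r)) L))"
  using assms(3,5)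
proof (induction m arbitrary: L)
  case 0
  have b: "(1 - Q (2 * real r + 1)) * B (int r) L = A (int r) L - Q (2 * real r + 1) * A (int (Suc r)) L" for r
    using B_to_A[of "int r" L] by (simp add: add.commute)
  show ?case
    using chain_B[where J = J and j = J and w = w and k = k, OF assms(1) 0(1) assms(4) le_refl] unfolding mult.assoc b by simp
next
  case (Suc m)
  define S where "S r = Q (2 * real r + 1) * Q (real m * (real (Suc r) ^ 2 - of_int l ^ 2))" for r
  have w: "w (k - (J + m)) M = Q (of_int M ^ 2 - of_int l ^ 2)" for M
    using assms(2)[of "J + m"] Suc.prems by simp
  define X where "X r M = Q (real m * (real r ^ 2 - of_int l ^ 2)) * A (int r) M
            - Q (2 * real r + 1) * Q (real m * (real (Suc r) ^ 2 - of_int l ^ 2)) * A (int (Suc r)) M" for r M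
  have "chain w k l b (Suc (J + m)) L = (\<Sum>r=nat \<bar>l\<bar>..R.
      Q (real r ^ 2 - of_int l ^ 2 + real J * (real r ^ 2 + real r - (of_int l ^ 2 + of_int l)))
        * (1 * (Q (real (Suc m) * (real r ^ 2 - of_int l ^ 2)) * A (int r) L
            - Q (2 * real r + 1) * Q (real (Suc m) * (real (Suc r) ^ 2 - of_int l ^ 2)) * A (int (Suc r)) L)))"
  proof (rule chain_step)
    show "chain w k l b (J + m) M = (\<Sum>r=nat \<bar>l\<bar>..R.
      Q (real r ^ 2 - of_int l ^ 2 + real J * (real r ^ 2 + real r - (of_int l ^ 2 + of_int l))) * X r M)"
      if "M \<le> l + int b" for M
      unfolding X_def by (rule Suc.IH) (use Suc.prems that in auto)
    show "(\<Sum>M\<in>{l..l + int b}. ip (L - M) * (w (k - (J + m)) M * X r M))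
      = 1 * (Q (real (Suc m) * (real r ^ 2 - of_int l ^ 2)) * A (int r) L
            - Q (2 * real r + 1) * Q (real (Suc m) * (real (Suc r) ^ 2 - of_int l ^ 2)) * A (int (Suc r)) L)"
      if "r \<in> {nat \<bar>l\<bar>..R}" for r
    proof -
      have s1: "(\<Sum>M\<in>{l..l + int b}. ip (L - M) * (Q (of_int M ^ 2 - of_int l ^ 2) * A (int r) M))
          = Q (real r ^ 2 - of_int l ^ 2) * A (int r) L"
        using that Suc.prems by (intro Bailey_step_A) auto
      have s2: "(\<Sum>M\<in>{l..l + int b}. ip (L - M) * (Q (of_int M ^ 2 - of_int l ^ 2) * A (int (Suc r)) M))
          = Q (real (Suc r) ^ 2 - of_int l ^ 2) * A (int (Suc r)) L"
        using that Suc.prems by (intro Bailey_step_A) auto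
      have e: "Q (real (Suc m) * y) = Q (real m * y) * Q y" for y
        unfolding Q_add[symmetric] by (rule arg_cong[of _ _ Q]) (simp add: algebra_simps)
      have "(\<Sum>M\<in>{l..l + int b}. ip (L - M) * (w (k - (J + m)) M * X r M))
        = Q (real m * (real r ^ 2 - of_int l ^ 2)) *
            (\<Sum>M\<in>{l..l + int b}. ip (L - M) * (Q (of_int M ^ 2 - of_int l ^ 2) * A (int r) M))
          - Q (2 * real r + 1) * Q (real m * (real (Suc r) ^ 2 - of_int l ^ 2)) *
            (\<Sum>M\<in>{l..l + int b}. ip (L - M) * (Q (of_int M ^ 2 - of_int l ^ 2) * A (int (Suc r)) M))"
        unfolding sum_distrib_left sum_subtractf[symmetric] w X_def
        by (intro sum.cong refl) (simp only: right_diff_distrib mult_ac)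
      then show ?thesis unfolding s1 s2 e by (simp only: mult_ac mult_1_left)
    qed
  qed
  then show ?case by simp
qed

section \<open>The finite identity\<close>

text \<open>
  The weights \<open>w\<^sub>j\<close> of the multiple series, as functions of \<open>M\<^sub>j = N\<^sub>j + l\<close>.
\<close>
definition weight :: "nat \<Rightarrow> nat \<Rightarrow> int \<Rightarrow> nat \<Rightarrow> int \<Rightarrow> complex" where
  "weight i k l j M =
     Q ((if j = 1 then 1 / 2 else 1) * (of_int M ^ 2 + of_int M - (of_int l ^ 2 + of_int l))
         - (if j \<le> k - i then of_int M - of_int l else 0))
       * (if j = 1 then qpoch (- q) q (nat M) else 1)"

text \<open>
  The exponent \<open>(k + 1/2) (x\<^sup>2 - l\<^sup>2) + (i - 1/2) (x - l)\<close> of the theta-like series.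
\<close>
definition expo :: "nat \<Rightarrow> nat \<Rightarrow> int \<Rightarrow> real \<Rightarrow> real" where
  "expo i k l x = (real k + 1 / 2) * (x ^ 2 - of_int l ^ 2) + (real i - 1 / 2) * (x - of_int l)"

lemma expo_complete_square:
  "(real k + 1 / 2) * (x + (2 * real i - 1) / (4 * real k + 2)) ^ 2
      - (2 * real k * of_int l + real i + of_int l - 1 / 2) ^ 2 / (4 * real k + 2) = expo i k l x"
proof -
  define d where "d = 4 * real k + 2"
  have d: "d \<noteq> 0" and k: "real k = (d - 2) / 4" by (simp_all add: d_def)
  show ?thesis
    unfolding expo_def d_def[symmetric] unfolding k using d
    by (simp add: field_simps power2_eq_square)
qed

lemma multi_summand_eq_tuple_term:
  fixes n :: "nat \<Rightarrow> nat" and k i :: nat and l :: int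
  defines "N \<equiv> \<lambda>j. real (tail_sum k n j)"
  assumes "k \<ge> 1"
  shows "multi_summand \<tau> k l
              (N 1 * (N 1 + 1) / 2 + (\<Sum>j=2..k. (N j)^2) + real_of_int l * N 1
                + (2 * real_of_int l + 1) * (\<Sum>j=2..k. N j) - (\<Sum>j=1..k-i. N j)) n
    = tuple_term (weight i k l) k l 1 n" (is "multi_summand \<tau> k l ?e n = _")
proof -
  define e where "e j = (if j = 1 then 1 / 2 else 1) * ((N j + of_int l) ^ 2 + (N j + of_int l) - (of_int l ^ 2 + of_int l))
         - (if j \<le> k - i then N j else 0)" for j
  have w: "weight i k l j (int (tail_sum k n j) + l)
      = Q (e j) * (if j = 1 then qpoch (- q) q (nat (int (tail_sum k n 1) + l)) else 1)" for j
    by (simp add: weight_def e_def N_def)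
  have ips: "(\<Prod>j=1..k. ip (int (n j))) = 1 / (\<Prod>r=1..k. qpoch q q (n r))"
    by (simp add: inv_qpoch_def prod_dividef)
  have k: "{1..k} = insert 1 {2..k}" using \<open>k \<ge> 1\<close> by auto
  have "(\<Sum>j=1..k. if j \<le> k - i then N j else 0) = (\<Sum>j=1..k-i. N j)"
    by (intro sum.mono_neutral_cong_right) auto
  moreover have "(\<Sum>j=1..k. (if j = 1 then 1 / 2 else 1) * ((N j + of_int l) ^ 2 + (N j + of_int l) - (of_int l ^ 2 + of_int l)))
     = N 1 * (N 1 + 1) / 2 + (\<Sum>j=2..k. (N j)^2) + real_of_int l * N 1 + (2 * real_of_int l + 1) * (\<Sum>j=2..k. N j)"
  proof -
    have "(\<Sum>j=2..k. (if j = 1 then 1 / 2 else 1) * ((N j + of_int l) ^ 2 + (N j + of_int l) - (of_int l ^ 2 + of_int l)))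
       = (\<Sum>j=2..k. (N j)^2 + (2 * real_of_int l + 1) * N j)"
      by (intro sum.cong) (auto simp: power2_eq_square algebra_simps)
    then show ?thesis
      unfolding k by (simp add: sum.distrib sum_distrib_left power2_eq_square field_simps)
  qed
  ultimately have "(\<Sum>j=1..k. e j) = ?e"
    unfolding e_def sum_subtractf by simp
  then have "Q ?e = (\<Prod>j=1..k. Q (e j))"
    by (simp flip: Q_sum)
  moreover have "(\<Prod>j=1..k. if j = 1 then qpoch (- q) q (nat (int (tail_sum k n 1) + l)) else 1)
      = qpoch (- q) q (nat (int (tail_sum k n 1) + l))"
    using \<open>k \<ge> 1\<close> by (simp add: prod.delta)
  ultimately show ?thesis
    unfolding tuple_term_def w prod.distrib ips multi_summand_def Let_def q_eq[symmetric]
    by simp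
qed

text \<open>
  The summand of the theta-like series: with the factor \<open>1 + q\<^sup>n\<close> for \<open>i < k\<close>, and in the simplified
  form without it for \<open>i = k\<close>.
\<close>
definition theta_term :: "nat \<Rightarrow> nat \<Rightarrow> int \<Rightarrow> int \<Rightarrow> complex" where
  "theta_term i k l n = Q (expo i k l (of_int n)) * (if i < k then 1 + Q (of_int n) else 1)"

text \<open>
  For \<open>i < k\<close>: \<open>i\<close> steps on the \<open>B\<^sub>r\<close>, then \<open>k - 1 - i\<close> steps on the \<open>A\<^sub>r\<close>, then the final step
  on the \<open>A\<^sub>r\<close>.
\<close>
lemma finite_identity_less:
  assumes "i < k" "1 \<le> l + int b"
  shows "(\<Sum>n\<in>PiE {1..k} (\<lambda>_. {..b}). ip (int b - int (tail_sum k n 1)) * tuple_term (weight i k l) k l 1 n)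
    = qpoch (- q) q (nat (l + int b) - 1) *
      (\<Sum>r=nat \<bar>l\<bar>..nat \<bar>l\<bar> + b. theta_term i k l (int r) * A (int r) (l + int b)
          - theta_term i k l (-1 - int r) * A (int (Suc r)) (l + int b))"
proof -
  define w where "w = weight i k l"
  define L where "L = l + int b"
  define m where "m = k - 1 - i"
  have k: "k = Suc (i + m)" using assms(1) by (simp add: m_def)
  define P where "P = qpoch (- q) q (nat L - 1)"
  \<comment> \<open>The exponent of the outermost weight is \<open>(M\<^sup>2 - M) / 2\<close> minus its value at \<open>l\<close>.\<close>
  define lc where "lc = (real_of_int l ^ 2 - of_int l) / 2"
  have w1: "w 1 M = Q ((of_int M ^ 2 - of_int M) / 2 - lc) * qpoch (-q) q (nat M)" for M
  proof -
    have e: "1 / 2 * (of_int M ^ 2 + of_int M - (of_int l ^ 2 + of_int l)) - (of_int M - of_int l)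
       = (of_int M ^ 2 - of_int M) / 2 - lc"
      by (simp add: lc_def field_simps)
    show ?thesis using assms(1) by (simp add: w_def weight_def Suc_le_eq flip: e)
  qed
  have "(\<Sum>n\<in>PiE {1..k} (\<lambda>_. {..b}). ip (int b - int (tail_sum k n 1)) * tuple_term w k l 1 n)
      = chain w k l b (Suc (i + m)) L"
    using chain_eq_tuple_sum[of "i + m" k L l b w] by (simp add: k L_def)
  also have "\<dots> = (\<Sum>r=nat \<bar>l\<bar>..nat \<bar>l\<bar> + b.
      Q (real r ^ 2 - of_int l ^ 2 + real i * (real r ^ 2 + real r - (of_int l ^ 2 + of_int l)))
        * (P * (Q (real m * (real r ^ 2 - of_int l ^ 2)) * (Q ((real r ^ 2 - real r) / 2 - lc) * (1 + Q (real r))) * A (int r) L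
            - Q (2 * real r + 1) * Q (real m * (real (Suc r) ^ 2 - of_int l ^ 2))
               * (Q ((real (Suc r) ^ 2 - real (Suc r)) / 2 - lc) * (1 + Q (real (Suc r)))) * A (int (Suc r)) L)))"
  proof (rule chain_step)
    define X where "X r M = Q (real m * (real r ^ 2 - of_int l ^ 2)) * A (int r) M
            - Q (2 * real r + 1) * Q (real m * (real (Suc r) ^ 2 - of_int l ^ 2)) * A (int (Suc r)) M" for r M
    show "chain w k l b (i + m) M = (\<Sum>r=nat \<bar>l\<bar>..nat \<bar>l\<bar> + b.
      Q (real r ^ 2 - of_int l ^ 2 + real i * (real r ^ 2 + real r - (of_int l ^ 2 + of_int l))) * X r M)"
      if "M \<le> l + int b" for M
      unfolding X_def
      by (rule chain_A[where J' = "i + m"])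
        (use that in \<open>auto simp: w_def weight_def k add_ac diff_diff_eq\<close>)
    show "(\<Sum>M\<in>{l..l + int b}. ip (L - M) * (w (k - (i + m)) M * X r M))
      = P * (Q (real m * (real r ^ 2 - of_int l ^ 2)) * (Q ((real r ^ 2 - real r) / 2 - lc) * (1 + Q (real r))) * A (int r) L
            - Q (2 * real r + 1) * Q (real m * (real (Suc r) ^ 2 - of_int l ^ 2))
               * (Q ((real (Suc r) ^ 2 - real (Suc r)) / 2 - lc) * (1 + Q (real (Suc r)))) * A (int (Suc r)) L)"
      if "r \<in> {nat \<bar>l\<bar>..nat \<bar>l\<bar> + b}" for r
    proof -
      have s: "(\<Sum>M\<in>{l..l + int b}. ip (L - M) * (Q ((of_int M ^ 2 - of_int M) / 2 - lc) * qpoch (-q) q (nat M) * A (int r') M))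
          = Q ((real r' ^ 2 - real r') / 2 - lc) * (1 + Q (real r')) * P * A (int r') L" if "r \<le> r'" for r'
        unfolding P_def using that \<open>r \<in> _\<close> assms(2) by (intro final_step_A) (auto simp: L_def)
      have i: "k - (i + m) = 1" by (simp add: k)
      have "(\<Sum>M\<in>{l..l + int b}. ip (L - M) * (w (k - (i + m)) M * X r M))
        = Q (real m * (real r ^ 2 - of_int l ^ 2)) *
            (\<Sum>M\<in>{l..l + int b}. ip (L - M) * (Q ((of_int M ^ 2 - of_int M) / 2 - lc) * qpoch (-q) q (nat M) * A (int r) M))
          - Q (2 * real r + 1) * Q (real m * (real (Suc r) ^ 2 - of_int l ^ 2)) *
            (\<Sum>M\<in>{l..l + int b}. ip (L - M) * (Q ((of_int M ^ 2 - of_int M) / 2 - lc) * qpoch (-q) q (nat M) * A (int (Suc r)) M))"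
        unfolding sum_distrib_left sum_subtractf[symmetric] i w1 X_def
        by (intro sum.cong refl) (simp only: right_diff_distrib mult_ac)
      then show ?thesis unfolding s[OF le_refl] s[OF le_SucI[OF le_refl]]
        by (simp only: mult_ac right_diff_distrib)
    qed
  qed
  also have "\<dots> = (\<Sum>r=nat \<bar>l\<bar>..nat \<bar>l\<bar> + b. P *
        (theta_term i k l (int r) * A (int r) L - theta_term i k l (-1 - int r) * A (int (Suc r)) L))"
  proof (intro sum.cong refl)
    fix r
    define c where "c = real r ^ 2 - of_int l ^ 2 + real i * (real r ^ 2 + real r - (of_int l ^ 2 + of_int l))"
    have kr: "real k = real i + real m + 1" by (simp add: k)
    have e1: "theta_term i k l (int r)
      = Q c * Q (real m * (real r ^ 2 - of_int l ^ 2)) * Q ((real r ^ 2 - real r) / 2 - lc) * (1 + Q (real r))"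
    proof -
      have "expo i k l (real r) = c + real m * (real r ^ 2 - of_int l ^ 2) + ((real r ^ 2 - real r) / 2 - lc)"
        by (simp add: expo_def c_def lc_def kr field_simps)
      then show ?thesis using assms(1) by (simp add: theta_term_def Q_add)
    qed
    \<comment> \<open>Uses \<open>1 + q\<^bsup>-1-r\<^esup> = q\<^bsup>-1-r\<^esup> (1 + q\<^bsup>r+1\<^esup>)\<close>.\<close>
    have e2: "theta_term i k l (-1 - int r)
      = Q c * Q (2 * real r + 1) * Q (real m * (real (Suc r) ^ 2 - of_int l ^ 2)) * Q ((real (Suc r) ^ 2 - real (Suc r)) / 2 - lc)
          * (1 + Q (real (Suc r)))"
    proof -
      define x where "x = real r"
      have "expo i k l (- 1 - real r) + (- 1 - real r) = c + (2 * real r + 1) + real m * (real (Suc r) ^ 2 - of_int l ^ 2)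
          + ((real (Suc r) ^ 2 - real (Suc r)) / 2 - lc)"
        unfolding of_nat_Suc x_def[symmetric]
        by (simp add: expo_def c_def lc_def kr x_def[symmetric] power2_eq_square field_simps)
      then have "Q (expo i k l (- 1 - real r) + (- 1 - real r)) = Q c * Q (2 * real r + 1) * Q (real m * (real (Suc r) ^ 2 - of_int l ^ 2))
         * Q ((real (Suc r) ^ 2 - real (Suc r)) / 2 - lc)"
        by (simp only: Q_add)
      moreover have "theta_term i k l (-1 - int r) = Q (expo i k l (- 1 - real r) + (- 1 - real r)) * (1 + Q (real (Suc r)))"
        using assms(1) by (simp add: theta_term_def distrib_left flip: Q_add)
      ultimately show ?thesis by simp
    qed
    show "Q (real r ^ 2 - of_int l ^ 2 + real i * (real r ^ 2 + real r - (of_int l ^ 2 + of_int l)))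
        * (P * (Q (real m * (real r ^ 2 - of_int l ^ 2)) * (Q ((real r ^ 2 - real r) / 2 - lc) * (1 + Q (real r))) * A (int r) L
            - Q (2 * real r + 1) * Q (real m * (real (Suc r) ^ 2 - of_int l ^ 2))
               * (Q ((real (Suc r) ^ 2 - real (Suc r)) / 2 - lc) * (1 + Q (real (Suc r)))) * A (int (Suc r)) L))
       = P * (theta_term i k l (int r) * A (int r) L - theta_term i k l (-1 - int r) * A (int (Suc r)) L)"
      unfolding e1 e2 c_def[symmetric] by (simp only: mult_ac right_diff_distrib)
  qed
  finally show ?thesis by (simp only: sum_distrib_left w_def P_def L_def)
qed

text \<open>
  For \<open>i = k\<close> every step, including the final one, acts on the \<open>B\<^sub>r\<close>; only the result is expressed
  by the \<open>A\<^sub>r\<close>.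
\<close>
lemma finite_identity_eq:
  assumes "1 \<le> k"
  shows "(\<Sum>n\<in>PiE {1..k} (\<lambda>_. {..b}). ip (int b - int (tail_sum k n 1)) * tuple_term (weight k k l) k l 1 n)
    = qpoch (- q) q (nat (l + int b)) *
      (\<Sum>r=nat \<bar>l\<bar>..nat \<bar>l\<bar> + b. theta_term k k l (int r) * A (int r) (l + int b)
          - theta_term k k l (-1 - int r) * A (int (Suc r)) (l + int b))"
proof -
  define w where "w = weight k k l"
  define L where "L = l + int b"
  obtain m where k: "k = Suc m" using assms by (cases k) auto
  define P where "P = qpoch (- q) q (nat L)"
  \<comment> \<open>The exponent of the outermost weight is \<open>(M\<^sup>2 + M) / 2\<close> minus its value at \<open>l\<close>.\<close>
  define lc where "lc = (real_of_int l ^ 2 + of_int l) / 2"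
  have w1: "w 1 M = Q ((of_int M ^ 2 + of_int M) / 2 - lc) * qpoch (-q) q (nat M)" for M
  proof -
    have e: "1 / 2 * (of_int M ^ 2 + of_int M - (of_int l ^ 2 + of_int l)) = (of_int M ^ 2 + of_int M) / 2 - lc"
      by (simp add: lc_def field_simps)
    show ?thesis by (simp add: w_def weight_def flip: e)
  qed
  have "(\<Sum>n\<in>PiE {1..k} (\<lambda>_. {..b}). ip (int b - int (tail_sum k n 1)) * tuple_term w k l 1 n)
      = chain w k l b (Suc m) L"
    using chain_eq_tuple_sum[of m k L l b w] by (simp add: k L_def)
  also have "\<dots> = (\<Sum>r=nat \<bar>l\<bar>..nat \<bar>l\<bar> + b.
      (Q (real r ^ 2 - of_int l ^ 2 + real m * (real r ^ 2 + real r - (of_int l ^ 2 + of_int l))) * (1 - Q (2 * real r + 1)))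
        * ((Q ((real r ^ 2 + real r) / 2 - lc) * P) * B (int r) L))"
  proof (rule chain_step)
    show "chain w k l b m M = (\<Sum>r=nat \<bar>l\<bar>..nat \<bar>l\<bar> + b.
      (Q (real r ^ 2 - of_int l ^ 2 + real m * (real r ^ 2 + real r - (of_int l ^ 2 + of_int l))) * (1 - Q (2 * real r + 1))) * B (int r) M)"
      if "M \<le> l + int b" for M
      by (rule chain_B[where J = m])
        (use that in \<open>auto simp: w_def weight_def k\<close>)
    show "(\<Sum>M\<in>{l..l + int b}. ip (L - M) * (w (k - m) M * B (int r) M))
      = Q ((real r ^ 2 + real r) / 2 - lc) * P * B (int r) L"
      if "r \<in> {nat \<bar>l\<bar>..nat \<bar>l\<bar> + b}" for r
    proof -
      have i: "k - m = 1" by (simp add: k)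
      show ?thesis
        unfolding P_def i w1 using that by (intro final_step_B) (auto simp: L_def)
    qed
  qed
  also have "\<dots> = (\<Sum>r=nat \<bar>l\<bar>..nat \<bar>l\<bar> + b. P *
        (theta_term k k l (int r) * A (int r) L - theta_term k k l (-1 - int r) * A (int (Suc r)) L))"
  proof (intro sum.cong refl)
    fix r
    define c where "c = real r ^ 2 - of_int l ^ 2 + real m * (real r ^ 2 + real r - (of_int l ^ 2 + of_int l))"
    have kr: "real k = real m + 1" by (simp add: k)
    have "expo k k l (real r) = c + ((real r ^ 2 + real r) / 2 - lc)"
      by (simp add: expo_def c_def lc_def kr field_simps)
    then have e1: "theta_term k k l (int r) = Q c * Q ((real r ^ 2 + real r) / 2 - lc)"
      by (simp add: theta_term_def Q_add)
    have "expo k k l (- 1 - real r) = c + (2 * real r + 1) + ((real r ^ 2 + real r) / 2 - lc)"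
      by (simp add: expo_def c_def lc_def kr power2_eq_square field_simps)
    then have e2: "theta_term k k l (-1 - int r) = Q c * Q (2 * real r + 1) * Q ((real r ^ 2 + real r) / 2 - lc)"
      by (simp add: theta_term_def Q_add)
    have b: "(1 - Q (2 * real r + 1)) * B (int r) L = A (int r) L - Q (2 * real r + 1) * A (int (Suc r)) L"
      using B_to_A[of "int r" L] by (simp add: add.commute)
    have "(Q c * (1 - Q (2 * real r + 1))) * ((Q ((real r ^ 2 + real r) / 2 - lc) * P) * B (int r) L)
      = P * (Q c * Q ((real r ^ 2 + real r) / 2 - lc) * ((1 - Q (2 * real r + 1)) * B (int r) L))"
      by (simp only: mult_ac)
    also have "\<dots> = P * (theta_term k k l (int r) * A (int r) L - theta_term k k l (-1 - int r) * A (int (Suc r)) L)"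
      unfolding b e1 e2 by (simp only: mult_ac right_diff_distrib)
    finally show "(Q (real r ^ 2 - of_int l ^ 2 + real m * (real r ^ 2 + real r - (of_int l ^ 2 + of_int l))) * (1 - Q (2 * real r + 1)))
        * ((Q ((real r ^ 2 + real r) / 2 - lc) * P) * B (int r) L)
       = P * (theta_term k k l (int r) * A (int r) L - theta_term k k l (-1 - int r) * A (int (Suc r)) L)"
      unfolding c_def .
  qed
  finally show ?thesis by (simp only: sum_distrib_left w_def P_def L_def)
qed

section \<open>Convergence\<close>

lemma convergent_prod_qpoch: "convergent_prod (\<lambda>j. 1 - a * q ^ j)"
proof -
  have "summable (\<lambda>j. norm ((1 - a * q ^ j) - 1))"
    by (simp add: norm_mult norm_power norm_q_less_1)
  then show ?thesis
    by (rule abs_convergent_prod_imp_convergent_prod[OF summable_imp_abs_convergent_prod])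
qed

lemma qpoch_LIMSEQ: "(\<lambda>n. qpoch a q n) \<longlonglongrightarrow> qpoch_inf a q"
proof -
  have "(\<lambda>n. \<Prod>j\<le>n. 1 - a * q ^ j) \<longlonglongrightarrow> qpoch_inf a q"
    unfolding qpoch_inf_def by (rule convergent_prod_LIMSEQ[OF convergent_prod_qpoch])
  moreover have "(\<Prod>j\<le>n. 1 - a * q ^ j) = qpoch a q (Suc n)" for n
    by (induction n) (simp_all add: qpoch_Suc)
  ultimately show ?thesis by (simp add: LIMSEQ_imp_Suc)
qed

lemma qpoch_inf_nonzero: "qpoch_inf q q \<noteq> 0"
  unfolding qpoch_inf_def
  by (rule prodinf_nonzero[OF convergent_prod_qpoch]) (use q_power_neq_1 in auto)

lemma qpoch_bounded: "\<exists>K>0. \<forall>n. norm (qpoch a q n) \<le> K"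
  using convergent_imp_Bseq[OF convergentI[OF qpoch_LIMSEQ]] by (auto simp: Bseq_def)

lemma ip_LIMSEQ: "(\<lambda>b. ip (int b + m)) \<longlonglongrightarrow> 1 / qpoch_inf q q"
proof -
  have "(\<lambda>n. ip (int n)) \<longlonglongrightarrow> 1 / qpoch_inf q q"
    using tendsto_divide[OF tendsto_const[of 1] qpoch_LIMSEQ[of q] qpoch_inf_nonzero]
    by (simp add: inv_qpoch_def)
  moreover have "filterlim (\<lambda>b. nat (int b + m)) sequentially sequentially"
    unfolding filterlim_at_top
  proof
    fix Z
    show "\<forall>\<^sub>F b in sequentially. Z \<le> nat (int b + m)"
      using eventually_ge_at_top[of "nat (int Z - m)"] by eventually_elim auto
  qed
  ultimately have "(\<lambda>b. ip (int (nat (int b + m)))) \<longlonglongrightarrow> 1 / qpoch_inf q q"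
    by (rule filterlim_compose)
  moreover have "\<forall>\<^sub>F b in sequentially. ip (int (nat (int b + m))) = ip (int b + m)"
    using eventually_ge_at_top[of "nat (- m)"] by eventually_elim auto
  ultimately show ?thesis by (rule Lim_transform_eventually)
qed

lemma ip_bounded: "\<exists>K>0. \<forall>m. norm (ip m) \<le> K"
proof -
  have "Bseq (\<lambda>n. ip (int n + 0))"
    by (rule convergent_imp_Bseq[OF convergentI[OF ip_LIMSEQ]])
  then obtain K where K: "K > 0" "\<And>n. norm (ip (int n)) \<le> K"
    by (auto simp: Bseq_def)
  have "norm (ip m) \<le> K" for m
    using K(2)[of "nat m"] K(1) by (cases "m < 0") auto
  with K(1) show ?thesis by blast
qed

lemma norm_q_abs_summable: "(\<lambda>n::int. norm q ^ nat \<bar>n\<bar>) summable_on UNIV"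
proof -
  have nat: "(\<lambda>n::nat. norm q ^ n) summable_on UNIV"
    using norm_q_less_1 by (subst summable_on_UNIV_nonneg_real_iff) (auto intro: summable_geometric)
  have "(\<lambda>n::int. norm q ^ nat \<bar>n\<bar>) summable_on range int"
    by (subst summable_on_reindex) (use nat in \<open>auto simp: o_def\<close>)
  moreover have "(\<lambda>n::int. norm q ^ nat \<bar>n\<bar>) summable_on range (\<lambda>n. - int n)"
    by (subst summable_on_reindex) (use nat in \<open>auto simp: o_def inj_on_def\<close>)
  ultimately have "(\<lambda>n::int. norm q ^ nat \<bar>n\<bar>) summable_on (range int \<union> range (\<lambda>n. - int n))"
    by (rule summable_on_union)
  moreover have "range int \<union> range (\<lambda>n. - int n) = UNIV"
  proof -
    have "x \<in> range int \<union> range (\<lambda>n. - int n)" for x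
      by (cases x rule: int_cases2) auto
    then show ?thesis by auto
  qed
  ultimately show ?thesis by simp
qed

lemma Q_norm_summable:
  assumes "\<And>n::int. \<bar>of_int n\<bar> - C \<le> P n"
  shows "(\<lambda>n. norm (Q (P n))) summable_on UNIV"
proof (rule summable_on_comparison_test)
  show "(\<lambda>n::int. norm (Q (- C)) * norm q ^ nat \<bar>n\<bar>) summable_on UNIV"
    by (rule summable_on_cmult_right[OF norm_q_abs_summable])
  show "norm (Q (P n)) \<le> norm (Q (- C)) * norm q ^ nat \<bar>n\<bar>" for n
  proof -
    have "norm (Q (P n)) \<le> norm (Q (- C + real (nat \<bar>n\<bar>)))"
      using assms[of n] by (intro norm_Q_le) simp
    then show ?thesis by (simp only: Q_add Q_of_nat norm_mult norm_power)
  qed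
qed auto

text \<open>
  A nonzero summand has \<open>|l| \<le> M\<^sub>j\<close> for all \<open>j\<close>. There the exponents with \<open>j \<ge> 2\<close> are nonnegative, and
  \<open>(M\<^sup>2 - M) / 2 \<ge> M - 1\<close> bounds the one with \<open>j = 1\<close> below by \<open>N\<^sub>1 = n\<^sub>1 + \<dots> + n\<^sub>k\<close> plus a constant.
\<close>
lemma norm_weight_le:
  assumes "\<And>n. norm (qpoch (- q) q n) \<le> K" and "\<bar>l\<bar> \<le> M"
  shows "norm (weight i k l j M)
    \<le> (if j = 1 then K * norm (Q (of_int M - 1 - (of_int l ^ 2 - of_int l) / 2)) else 1)"
proof -
  define x y :: real where "x = of_int M" and "y = of_int l"
  have yx: "\<bar>y\<bar> \<le> x" using assms(2) unfolding x_def y_def by linarith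
  then have sq: "y ^ 2 \<le> x ^ 2" by (metis abs_ge_zero order_trans abs_of_nonneg abs_le_square_iff)
  \<comment> \<open>No integer lies strictly between 1 and 2.\<close>
  have "0 \<le> (M - 1) * (M - 2)"
    by (cases "M \<le> 1") (auto intro: mult_nonpos_nonpos)
  then have "(0 :: real) \<le> of_int ((M - 1) * (M - 2))" by (simp only: of_int_0_le_iff)
  then have lin: "x - 1 \<le> (x ^ 2 - x) / 2"
    by (simp add: x_def power2_eq_square algebra_simps)
  show ?thesis
  proof (cases "j = 1")
    case True
    have "norm (Q (1 / 2 * (x ^ 2 + x - (y ^ 2 + y)) - (if j \<le> k - i then x - y else 0)))
        \<le> norm (Q (x - 1 - (y ^ 2 - y) / 2))"
      using lin yx by (intro norm_Q_le) (auto simp: field_simps)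
    then have "norm (weight i k l j M) \<le> norm (Q (x - 1 - (y ^ 2 - y) / 2)) * K"
      unfolding weight_def norm_mult x_def[symmetric] y_def[symmetric] using True assms(1)
      by (intro mult_mono) auto
    then show ?thesis using True by (simp add: x_def y_def mult.commute)
  next
    case False
    have "norm (Q (x ^ 2 + x - (y ^ 2 + y) - (if j \<le> k - i then x - y else 0))) \<le> norm (Q 0)"
      using sq yx by (intro norm_Q_le) auto
    then show ?thesis using False by (cases "j \<le> k - i") (simp_all add: weight_def x_def y_def)
  qed
qed

text \<open>
  The summand is dominated by a constant times the product of the geometric terms \<open>|q|\<^bsup>n\<^sub>j\<^esup>\<close>.
\<close>
lemma tuple_term_summable:
  assumes "k \<ge> 1"
  shows "(\<lambda>n. norm (tuple_term (weight i k l) k l 1 n)) summable_on tuples k"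
proof -
  obtain K where K: "K > 0" "\<And>m. norm (ip m) \<le> K" using ip_bounded by blast
  obtain K' where K': "K' > 0" "\<And>n. norm (qpoch (- q) q n) \<le> K'" using qpoch_bounded by blast
  define c where "c = real_of_int l - 1 - (of_int l ^ 2 - of_int l) / 2"
  define D where "D = K * K ^ k * (K' * norm (Q c))"
  have bound: "norm (tuple_term (weight i k l) k l 1 n) \<le> D * (\<Prod>j\<in>{1..k}. norm q ^ n j)" for n
  proof (cases "int (n k) + 2 * l < 0")
    case True
    then show ?thesis using K(1) K'(1) by (simp add: tuple_term_def D_def prod_nonneg)
  next
    case False
    define N where "N j = tail_sum k n j" for j
    have "norm (\<Prod>j=1..k. weight i k l j (int (N j) + l) * ip (int (n j)))
        \<le> (\<Prod>j=1..k. (if j = 1 then K' * norm (Q (real (N 1) + c)) else 1) * K)"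
      unfolding prod_norm[symmetric]
    proof (intro prod_mono conjI)
      fix j assume j: "j \<in> {1..k}"
      have "n k \<le> N j"
        unfolding N_def tail_sum_def using j by (intro member_le_sum) auto
      then have "\<bar>l\<bar> \<le> int (N j) + l" using False by linarith
      from norm_weight_le[OF K'(2) this, of i k j]
      have "norm (weight i k l j (int (N j) + l)) \<le> (if j = 1 then K' * norm (Q (real (N 1) + c)) else 1)"
        by (simp add: c_def algebra_simps split: if_splits)
      then show "norm (weight i k l j (int (N j) + l) * ip (int (n j)))
          \<le> (if j = 1 then K' * norm (Q (real (N 1) + c)) else 1) * K"
        unfolding norm_mult using K K'(1) by (intro mult_mono) auto
    qed auto
    also have "\<dots> = K' * norm (Q (real (N 1) + c)) * K ^ k"
      using assms by (simp add: prod.distrib prod.delta)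
    finally have "norm (tuple_term (weight i k l) k l 1 n) \<le> (K' * norm (Q (real (N 1) + c)) * K ^ k) * K"
      unfolding tuple_term_def N_def norm_mult[of _ "ip _"] using K K' by (intro mult_mono) auto
    also have "\<dots> = D * norm q ^ N 1"
      unfolding Q_add Q_of_nat norm_mult norm_power D_def by (simp only: mult_ac)
    also have "norm q ^ N 1 = (\<Prod>j\<in>{1..k}. norm q ^ n j)"
      by (simp add: N_def tail_sum_def power_sum)
    finally show ?thesis .
  qed
  have "(\<lambda>n::nat. norm q ^ n) summable_on UNIV"
    using norm_q_less_1 by (subst summable_on_UNIV_nonneg_real_iff) (auto intro: summable_geometric)
  then have "Infinite_Set_Sum.abs_summable_on (\<lambda>n::nat. norm q ^ n) UNIV"
    unfolding abs_summable_equivalent[symmetric] by simp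
  then have "Infinite_Set_Sum.abs_summable_on (\<lambda>n. \<Prod>j\<in>{1..k}. norm q ^ n j) (PiE {1..k} (\<lambda>_. UNIV :: nat set))"
    by (intro abs_summable_on_prod_PiE) auto
  then have "(\<lambda>n. \<Prod>j\<in>{1..k}. norm q ^ n j) summable_on tuples k"
    unfolding abs_summable_equivalent[symmetric] tuples_def by (rule abs_summable_summable)
  then have "(\<lambda>n. D * (\<Prod>j\<in>{1..k}. norm q ^ n j)) summable_on tuples k"
    by (rule summable_on_cmult_right)
  then show ?thesis
    by (rule summable_on_comparison_test) (use bound in auto)
qed

lemma Q_expo_summable:
  assumes "k \<ge> 1" "i \<le> k"
  shows "(\<lambda>n::int. norm (Q (expo i k l (of_int n)))) summable_on UNIV"
    and "(\<lambda>n::int. norm (Q (expo i k l (of_int n)) * (1 + Q (of_int n)))) summable_on UNIV"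
proof -
  define c where "c = (real k + 1 / 2) * of_int l ^ 2 + (real i - 1 / 2) * of_int l"
  have s0: "(\<lambda>n::int. norm (Q (expo i k l (of_int n)))) summable_on UNIV"
  proof (rule Q_norm_summable)
    show "\<bar>of_int n\<bar> - (2 * (real k + 1 / 2) + c) \<le> expo i k l (of_int n)" for n
    proof -
      have "\<bar>real i - 1 / 2\<bar> \<le> real k + 1 / 2" using assms by linarith
      from quadratic_bound[OF _ this, of n] show ?thesis
        by (simp add: expo_def c_def field_simps)
    qed
  qed
  have s1: "(\<lambda>n::int. norm (Q (expo i k l (of_int n) + of_int n))) summable_on UNIV"
  proof (rule Q_norm_summable)
    show "\<bar>of_int n\<bar> - (2 * (real k + 1 / 2) + c) \<le> expo i k l (of_int n) + of_int n" for n
    proof -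
      have "\<bar>real i + 1 / 2\<bar> \<le> real k + 1 / 2" using assms by linarith
      from quadratic_bound[OF _ this, of n] show ?thesis
        by (simp add: expo_def c_def field_simps)
    qed
  qed
  show "(\<lambda>n::int. norm (Q (expo i k l (of_int n)))) summable_on UNIV" by (rule s0)
  show "(\<lambda>n::int. norm (Q (expo i k l (of_int n)) * (1 + Q (of_int n)))) summable_on UNIV"
  proof (rule summable_on_comparison_test[OF summable_on_add[OF s0 s1]])
    show "norm (Q (expo i k l (of_int n)) * (1 + Q (of_int n)))
        \<le> norm (Q (expo i k l (of_int n))) + norm (Q (expo i k l (of_int n) + of_int n))" for n
      unfolding Q_add distrib_left by (rule order_trans[OF norm_triangle_ineq]) simp
  qed auto
qed

lemma theta_term_summable:
  assumes "k \<ge> 1" "i \<le> k"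
  shows "(\<lambda>n. norm (theta_term i k l n)) summable_on UNIV"
  using Q_expo_summable[OF assms, of l] by (cases "i < k") (simp_all add: theta_term_def)

section \<open>Passage to the limit\<close>

text \<open>
  With \<open>L = l + b\<close>, the factor \<open>1 / (q)\<^bsub>L - M\<^sub>1\<^esub>\<close> tends to \<open>1 / (q)\<^sub>\<infinity>\<close> and \<open>A\<^sub>r(L)\<close> to
  \<open>1 / (q)\<^sub>\<infinity>\<^sup>2\<close> as \<open>b \<rightarrow> \<infinity>\<close>, so that one factor \<open>1 / (q)\<^sub>\<infinity>\<close> is left.
\<close>
lemma limit_identity:
  fixes c1 c2 :: "nat \<Rightarrow> complex"
  assumes g: "(\<lambda>n. norm (g n)) summable_on tuples k"
    and c: "(\<lambda>r. norm (c1 r)) summable_on {nat \<bar>l\<bar>..}" "(\<lambda>r. norm (c2 r)) summable_on {nat \<bar>l\<bar>..}"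
    and P: "P \<longlonglongrightarrow> p"
    and fin: "\<forall>\<^sub>F b in sequentially. (\<Sum>n\<in>PiE {1..k} (\<lambda>_. {..b}). ip (int b - int (tail_sum k n 1)) * g n)
        = P b * (\<Sum>r=nat \<bar>l\<bar>..nat \<bar>l\<bar> + b. c1 r * A (int r) (l + int b) - c2 r * A (int (Suc r)) (l + int b))"
  shows "infsum g (tuples k) = p / qpoch_inf q q * infsum (\<lambda>r. c1 r - c2 r) {nat \<bar>l\<bar>..}"
proof -
  obtain K where K: "K > 0" "\<And>m. norm (ip m) \<le> K" using ip_bounded by blast
  define z where "z = 1 / qpoch_inf q q"
  have lhs: "(\<Sum>n\<in>PiE {1..k} (\<lambda>_. {..b}). ip (int b - int (tail_sum k n 1)) * g n)
      = infsum (\<lambda>n. ip (int b - int (tail_sum k n 1)) * g n) (tuples k)" for b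
  proof -
    have "n \<in> PiE {1..k} (\<lambda>_. {..b})" if n: "n \<in> tuples k" and "tail_sum k n 1 \<le> b" for n
    proof -
      have "n j \<le> tail_sum k n 1" if "j \<in> {1..k}" for j
        unfolding tail_sum_def using that by (intro member_le_sum) auto
      then have "\<forall>j\<in>{1..k}. n j \<le> b"
        using \<open>tail_sum k n 1 \<le> b\<close> by (metis order_trans)
      then show ?thesis
        using n by (simp add: tuples_def PiE_iff)
    qed
    then have "infsum (\<lambda>n. ip (int b - int (tail_sum k n 1)) * g n) (tuples k)
      = infsum (\<lambda>n. ip (int b - int (tail_sum k n 1)) * g n) (PiE {1..k} (\<lambda>_. {..b}))"
    proof (intro infsum_cong_neutral)
      fix n assume "n \<in> tuples k - (PiE {1..k} (\<lambda>_. {..b}))"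
      then have "\<not> tail_sum k n 1 \<le> b" using \<open>\<And>n. n \<in> tuples k \<Longrightarrow> tail_sum k n 1 \<le> b \<Longrightarrow> n \<in> _\<close> by blast
      then show "ip (int b - int (tail_sum k n 1)) * g n = 0" by simp
    qed (auto simp: tuples_def PiE_iff)
    then show ?thesis by (simp add: finite_PiE)
  qed
  have A_lim: "(\<lambda>b. A r (l + int b)) \<longlonglongrightarrow> z * z" for r
    using tendsto_mult[OF ip_LIMSEQ[of "l - r"] ip_LIMSEQ[of "l + r"]]
    by (simp add: A_def z_def algebra_simps)
  have A_bound: "norm (A r M) \<le> K * K" for r M
    unfolding A_def norm_mult using K by (intro mult_mono) (auto simp: less_imp_le)
  have summ: "(\<lambda>r. A (h r) M * c r) summable_on {nat \<bar>l\<bar>..}"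
    if "(\<lambda>r. norm (c r)) summable_on {nat \<bar>l\<bar>..}" for c and h :: "nat \<Rightarrow> int" and M
  proof (rule abs_summable_summable, rule summable_on_comparison_test)
    show "(\<lambda>r. K * K * norm (c r)) summable_on {nat \<bar>l\<bar>..}"
      using that by (rule summable_on_cmult_right)
    show "norm (A (h r) M * c r) \<le> K * K * norm (c r)" for r
      unfolding norm_mult[of "A _ _"] by (intro mult_right_mono A_bound) auto
  qed auto
  have rhs: "(\<Sum>r=nat \<bar>l\<bar>..nat \<bar>l\<bar> + b. c1 r * A (int r) (l + int b) - c2 r * A (int (Suc r)) (l + int b))
     = infsum (\<lambda>r. A (int r) (l + int b) * c1 r) {nat \<bar>l\<bar>..} - infsum (\<lambda>r. A (int (Suc r)) (l + int b) * c2 r) {nat \<bar>l\<bar>..}" for b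
  proof -
    have "infsum (\<lambda>r. A (int r) (l + int b) * c1 r - A (int (Suc r)) (l + int b) * c2 r) {nat \<bar>l\<bar>..}
       = infsum (\<lambda>r. A (int r) (l + int b) * c1 r - A (int (Suc r)) (l + int b) * c2 r) {nat \<bar>l\<bar>..nat \<bar>l\<bar> + b}"
      \<comment> \<open>For \<open>r > |l| + b\<close> both kernels vanish at \<open>l + b\<close>.\<close>
      by (intro infsum_cong_neutral) (auto simp: A_eq_0)
    then show ?thesis
      unfolding infsum_diff[OF summ[OF c(1), of int] summ[OF c(2), of "\<lambda>r. int (Suc r)"]]
      by (simp add: mult.commute)
  qed
  have "(\<lambda>b. infsum (\<lambda>n. ip (int b - int (tail_sum k n 1)) * g n) (tuples k)) \<longlonglongrightarrow> z * infsum g (tuples k)"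
    using ip_LIMSEQ[of "- int (tail_sum k _ 1)"]
    by (intro tendsto_weighted_infsum[OF g K(2)]) (simp add: z_def)
  then have "(\<lambda>b. P b * (infsum (\<lambda>r. A (int r) (l + int b) * c1 r) {nat \<bar>l\<bar>..} - infsum (\<lambda>r. A (int (Suc r)) (l + int b) * c2 r) {nat \<bar>l\<bar>..}))
     \<longlonglongrightarrow> z * infsum g (tuples k)"
    by (rule Lim_transform_eventually) (use fin in \<open>simp only: lhs rhs\<close>)
  moreover have "(\<lambda>b. P b * (infsum (\<lambda>r. A (int r) (l + int b) * c1 r) {nat \<bar>l\<bar>..} - infsum (\<lambda>r. A (int (Suc r)) (l + int b) * c2 r) {nat \<bar>l\<bar>..}))
     \<longlonglongrightarrow> p * (z * z * infsum c1 {nat \<bar>l\<bar>..} - z * z * infsum c2 {nat \<bar>l\<bar>..})"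
    by (intro tendsto_mult tendsto_diff P tendsto_weighted_infsum[OF c(1) A_bound A_lim] tendsto_weighted_infsum[OF c(2) A_bound A_lim])
  ultimately have "z * infsum g (tuples k) = p * (z * z * infsum c1 {nat \<bar>l\<bar>..} - z * z * infsum c2 {nat \<bar>l\<bar>..})"
    by (rule LIMSEQ_unique)
  also have "\<dots> = z * (p * z * (infsum c1 {nat \<bar>l\<bar>..} - infsum c2 {nat \<bar>l\<bar>..}))"
    by (simp only: right_diff_distrib mult_ac)
  also have "infsum c1 {nat \<bar>l\<bar>..} - infsum c2 {nat \<bar>l\<bar>..} = infsum (\<lambda>r. c1 r - c2 r) {nat \<bar>l\<bar>..}"
    by (rule infsum_diff[OF abs_summable_summable[OF c(1)] abs_summable_summable[OF c(2)], symmetric])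
  finally have "infsum g (tuples k) = p * z * infsum (\<lambda>r. c1 r - c2 r) {nat \<bar>l\<bar>..}"
    using qpoch_inf_nonzero unfolding z_def by (subst (asm) mult_left_cancel) auto
  then show ?thesis by (simp add: z_def)
qed

lemma theta_identity:
  assumes "k \<ge> 1" "i \<le> k"
  shows "qpoch_inf (- q) q / qpoch_inf q q *
      (infsum (theta_term i k l) {\<bar>l\<bar>..} - infsum (theta_term i k l) {..- \<bar>l\<bar> - 1})
    = infsum (tuple_term (weight i k l) k l 1) (tuples k)"
proof -
  \<comment> \<open>The prefactor of the finite identity is \<open>(-q)\<^bsub>L-1\<^esub>\<close> for \<open>i < k\<close> and \<open>(-q)\<^sub>L\<close> for \<open>i = k\<close>.\<close>
  define d where "d = (if i < k then 1 else 0 :: nat)"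
  define P where "P b = qpoch (- q) q (nat (l + int b) - d)" for b
  have "filterlim (\<lambda>b. nat (l + int b) - d) sequentially sequentially"
    unfolding filterlim_at_top
  proof
    fix Z
    show "\<forall>\<^sub>F b in sequentially. Z \<le> nat (l + int b) - d"
      using eventually_ge_at_top[of "nat (int Z + int d - l)"] by eventually_elim auto
  qed
  then have "P \<longlonglongrightarrow> qpoch_inf (- q) q"
    unfolding P_def by (rule filterlim_compose[OF qpoch_LIMSEQ])
  moreover have "\<forall>\<^sub>F b in sequentially. (\<Sum>n\<in>PiE {1..k} (\<lambda>_. {..b}). ip (int b - int (tail_sum k n 1)) * tuple_term (weight i k l) k l 1 n)
        = P b * (\<Sum>r=nat \<bar>l\<bar>..nat \<bar>l\<bar> + b. theta_term i k l (int r) * A (int r) (l + int b)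
          - theta_term i k l (- 1 - int r) * A (int (Suc r)) (l + int b))"
    using eventually_ge_at_top[of "nat (1 - l)"]
  proof eventually_elim
    case (elim b)
    then have "1 \<le> l + int b" by linarith
    then show ?case
      using finite_identity_less[of i k l b] finite_identity_eq[of k b l] assms
      by (cases "i < k") (auto simp: P_def d_def)
  qed
  ultimately have "infsum (tuple_term (weight i k l) k l 1) (tuples k)
    = qpoch_inf (- q) q / qpoch_inf q q * infsum (\<lambda>r. theta_term i k l (int r) - theta_term i k l (- 1 - int r)) {nat \<bar>l\<bar>..}"
    by (intro limit_identity tuple_term_summable abs_summable_int_fold(1,2) theta_term_summable assms)
  then show ?thesis
    using abs_summable_int_fold(5)[OF theta_term_summable[OF assms]] by simp
qed

text \<open>
  For \<open>i = k\<close> the terms with the additional factor \<open>q\<^sup>n\<close> have the same value at \<open>n\<close> and at \<open>-1 - n\<close>.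
\<close>
lemma theta_pairing:
  "Q (expo k k l (of_int n)) * (1 + Q (of_int n)) - Q (expo k k l (of_int (- 1 - n))) * (1 + Q (of_int (- 1 - n)))
    = theta_term k k l n - theta_term k k l (- 1 - n)"
proof -
  have "expo k k l (of_int n) + of_int n = expo k k l (of_int (- 1 - n)) + of_int (- 1 - n)"
    by (simp add: expo_def power2_eq_square field_simps)
  then have "Q (expo k k l (of_int n)) * Q (of_int n) = Q (expo k k l (of_int (- 1 - n))) * Q (of_int (- 1 - n))"
    by (simp only: Q_add[symmetric])
  then show ?thesis by (simp add: theta_term_def distrib_left del: of_int_diff)
qed

lemma theta_identity_one_plus:
  assumes "k \<ge> 1" "i \<le> k"
  shows "qpoch_inf (- q) q / qpoch_inf q q *
      (infsum (\<lambda>n::int. Q (expo i k l (of_int n)) * (1 + Q (of_int n))) {\<bar>l\<bar>..}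
        - infsum (\<lambda>n::int. Q (expo i k l (of_int n)) * (1 + Q (of_int n))) {..- \<bar>l\<bar> - 1})
    = infsum (tuple_term (weight i k l) k l 1) (tuples k)"
proof (cases "i < k")
  case True
  then have "theta_term i k l = (\<lambda>n::int. Q (expo i k l (of_int n)) * (1 + Q (of_int n)))"
    by (simp add: theta_term_def fun_eq_iff)
  then show ?thesis using theta_identity[OF assms, of l] by simp
next
  case False
  then have "i = k" using assms(2) by simp
  then show ?thesis
    using abs_summable_int_fold(5)[OF Q_expo_summable(2)[OF assms, of l]]
      abs_summable_int_fold(5)[OF theta_term_summable[OF assms, of l]] theta_identity[OF assms, of l]
    by (simp only: theta_pairing)
qed

end

theorem proposition3p2:
  fixes \<tau> q :: complex and i k :: nat and l :: int
  assumes "Im \<tau> > 0"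
    and "q = qpow \<tau> 1"
    and "k \<ge> 1"
    and "i \<le> k"
  shows
    "(let f = (\<lambda>n::int.
            qpow \<tau> ((real k + 1/2) * (real_of_int n + (2 * real i - 1) / (4 * real k + 2))^2
              - (2 * real k * real_of_int l + real i + real_of_int l - 1/2)^2 / (4 * real k + 2))
            * (1 + qpow \<tau> (real_of_int n)));
          g = (\<lambda>n. let N = (\<lambda>j. real (tail_sum k n j)) in
            multi_summand \<tau> k l
              (N 1 * (N 1 + 1) / 2 + (\<Sum>j=2..k. (N j)^2) + real_of_int l * N 1
                + (2 * real_of_int l + 1) * (\<Sum>j=2..k. N j) - (\<Sum>j=1..k-i. N j)) n)
      in f summable_on {\<bar>l\<bar>..} \<and> f summable_on {..-\<bar>l\<bar>-1} \<and> g summable_on tuples k \<and>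
         qpoch_inf (- q) q / qpoch_inf q q * (infsum f {\<bar>l\<bar>..} - infsum f {..-\<bar>l\<bar>-1})
           = infsum g (tuples k))
     \<and>
     (let f = (\<lambda>n::int.
            qpow \<tau> ((real k + 1/2) * (real_of_int n + (2 * real k - 1) / (4 * real k + 2))^2
              - (2 * real k * real_of_int l + real k + real_of_int l - 1/2)^2 / (4 * real k + 2)));
          g = (\<lambda>n. let N = (\<lambda>j. real (tail_sum k n j)) in
            multi_summand \<tau> k l
              (N 1 * (N 1 + 1) / 2 + (\<Sum>j=2..k. (N j)^2) + real_of_int l * N 1
                + (2 * real_of_int l + 1) * (\<Sum>j=2..k. N j)) n)
      in f summable_on {\<bar>l\<bar>..} \<and> f summable_on {..-\<bar>l\<bar>-1} \<and> g summable_on tuples k \<and>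
         qpoch_inf (- q) q / qpoch_inf q q * (infsum f {\<bar>l\<bar>..} - infsum f {..-\<bar>l\<bar>-1})
           = infsum g (tuples k))"
proof -
  interpret nome \<tau> q by unfold_locales (use assms in auto)
  have g: "multi_summand \<tau> k l (real (tail_sum k n 1) * (real (tail_sum k n 1) + 1) / 2
        + (\<Sum>j=2..k. (real (tail_sum k n j))^2) + real_of_int l * real (tail_sum k n 1)
        + (2 * real_of_int l + 1) * (\<Sum>j=2..k. real (tail_sum k n j))) n
      = tuple_term (weight k k l) k l 1 n" for n
    using multi_summand_eq_tuple_term[OF assms(3), where l = l and i = k] by simp
  have f: "(\<lambda>n. Q (expo k k l (of_int n))) = theta_term k k l"
    by (simp add: theta_term_def fun_eq_iff)
  show ?thesis
    unfolding Let_def expo_complete_square multi_summand_eq_tuple_term[OF assms(3)] g f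
    using abs_summable_int_fold(3,4)[OF Q_expo_summable(2)[OF assms(3,4), of l], of l]
      abs_summable_int_fold(3,4)[OF theta_term_summable[OF assms(3) le_refl, of l], of l]
      abs_summable_summable[OF tuple_term_summable[OF assms(3), of i l]]
      abs_summable_summable[OF tuple_term_summable[OF assms(3), of k l]]
      theta_identity_one_plus[OF assms(3,4), of l] theta_identity[OF assms(3) le_refl, of l]
    by (intro conjI) assumption+
qed

end
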